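(* Let $(A,\rho)$ be an involutive complex anchored vector bundle over $M$ with constant real rank. Then the real anchored vector bundle $(A^{\mathrm{re}},\rho^{\mathrm{re}})$ is involutive.
   Context: A complex (real) anchored vector bundle over a smooth real manifold $M$ is a complex (real) vector bundle $A\to M$ with a $\mathbb{C}$-linear bundle map $\rho:A\to T_{\mathbb{C}}M=TM\otimes\mathbb{C}$ (respectively an $\mathbb{R}$-linear bundle map $\rho:A\to TM$). It is involutive if $\rho(\Gamma(A))$ is a Lie subalgebra of $\Gamma(T_{\mathbb{C}}M)$ (respectively $\Gamma(TM)$). For a complex anchored vector bundle write $\rho=\rho_1+i\rho_2$ with $\rho_1,\rho_2:A\to TM$ real-linear; $A^{\mathrm{re}}=\ker\rho_2$ and $\rho^{\mathrm{re}}=\rho_1|_{A^{\mathrm{re}}}$. The real rank is $m\mapsto\dim_{\mathbb{R}}A^{\mathrm{re}}|_m$; when it is constant, $A^{\mathrm{re}}$ is a real vector bundle and $(A^{\mathrm{re}},\rho^{\mathrm{re}})$ is a real anchored vector bundle. *)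

theory Defs
  imports "HOL-Analysis.Analysis" "HOL-Library.Function_Algebras"
begin

section \<open>Smooth manifolds\<close>

text \<open>All derivatives below are taken on open sets.\<close>

fun diff_times_on :: "nat \<Rightarrow> 'e::real_normed_vector set \<Rightarrow> ('e \<Rightarrow> 'f::real_normed_vector) \<Rightarrow> bool" where
  "diff_times_on 0 S f \<longleftrightarrow> continuous_on S f"
| "diff_times_on (Suc k) S f \<longleftrightarrow>
     (\<forall>x\<in>S. f differentiable (at x)) \<and>
     (\<forall>v. diff_times_on k S (\<lambda>x. frechet_derivative f (at x) v))"

definition smooth_on :: "'e::real_normed_vector set \<Rightarrow> ('e \<Rightarrow> 'f::real_normed_vector) \<Rightarrow> bool" where
  "smooth_on S f \<longleftrightarrow> (\<forall>k. diff_times_on k S f)"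

text \<open>A chart is a pair of its domain and its coordinate map; values of the coordinate map
  outside the domain are irrelevant.\<close>

type_synonym ('m, 'e) chart = "'m set \<times> ('m \<Rightarrow> 'e)"

record ('m, 'e) manifold =
  mtop :: "'m topology"
  atlas :: "('m, 'e) chart set"

abbreviation points :: "('m, 'e) manifold \<Rightarrow> 'm set" where
  "points M \<equiv> topspace (mtop M)"

abbreviation chart_inv :: "('m, 'e) chart \<Rightarrow> 'e \<Rightarrow> 'm" where
  "chart_inv c \<equiv> inv_into (fst c) (snd c)"

definition is_chart :: "'m topology \<Rightarrow> ('m, 'e::real_normed_vector) chart \<Rightarrow> bool" where
  "is_chart T c \<longleftrightarrow> openin T (fst c) \<and> open (snd c ` fst c) \<and>
     homeomorphic_map (subtopology T (fst c)) (top_of_set (snd c ` fst c)) (snd c)"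

text \<open>The model space is any finite-dimensional normed space rather than one of class
  \<open>euclidean_space\<close>, because that class excludes dimension zero.\<close>

definition smooth_manifold :: "('m, 'e::real_normed_vector) manifold \<Rightarrow> bool" where
  "smooth_manifold M \<longleftrightarrow>
     (\<exists>B :: 'e set. finite B \<and> span B = UNIV) \<and>
     Hausdorff_space (mtop M) \<and> second_countable (mtop M) \<and>
     (\<forall>c\<in>atlas M. is_chart (mtop M) c) \<and>
     points M = (\<Union>c\<in>atlas M. fst c) \<and>
     (\<forall>c\<in>atlas M. \<forall>d\<in>atlas M. smooth_on (snd c ` (fst c \<inter> fst d)) (snd d \<circ> chart_inv c))"

text \<open>Smoothness on an open subset \<open>W\<close> of the manifold.\<close>

definition smooth_fun_on ::
    "('m, 'e::real_normed_vector) manifold \<Rightarrow> 'm set \<Rightarrow> ('m \<Rightarrow> 'f::real_normed_vector) \<Rightarrow> bool" where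
  "smooth_fun_on M W f \<longleftrightarrow> (\<forall>c\<in>atlas M. smooth_on (snd c ` (fst c \<inter> W)) (f \<circ> chart_inv c))"


section \<open>Smooth vector bundles\<close>

text \<open>The fibres are subspaces of an auxiliary vector space \<open>'v\<close> over the scalar field \<open>'k\<close> (which
  will be the real or the complex numbers). No topology on \<open>'v\<close> is used and distinct fibres are
  unrelated, so this is only a way to provide the vector space operations in each fibre; the
  total space is the disjoint union of the fibres, and its smooth structure is the one determined
  by the local trivializations.

  A local trivialization \<open>(U, n, \<phi>)\<close> is a family of linear isomorphisms \<open>\<phi> m\<close>, for \<open>m\<close> in the open
  set \<open>U\<close>, from the fibre at \<open>m\<close> onto \<open>'k\<close>-valued \<open>n\<close>-tuples, which are represented by functions on
  the natural numbers vanishing from \<open>n\<close> on. The rank is thus locally constant.\<close>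

type_synonym ('k, 'm, 'v) triv = "'m set \<times> nat \<times> ('m \<Rightarrow> 'v \<Rightarrow> nat \<Rightarrow> 'k)"

record ('k, 'm, 'v) vbundle =
  fibre :: "'m \<Rightarrow> 'v set"
  scl :: "'k \<Rightarrow> 'v \<Rightarrow> 'v"
  trivs :: "('k, 'm, 'v) triv set"

definition local_triv ::
    "('m, 'e::real_normed_vector) manifold \<Rightarrow> ('m \<Rightarrow> 'v::ab_group_add set)
      \<Rightarrow> ('k::real_normed_field \<Rightarrow> 'v \<Rightarrow> 'v) \<Rightarrow> ('k, 'm, 'v) triv \<Rightarrow> bool" where
  "local_triv M F s = (\<lambda>(U, n, \<phi>). openin (mtop M) U \<and>
     (\<forall>m\<in>U. bij_betw (\<phi> m) (F m) {x. \<forall>i\<ge>n. x i = 0} \<and>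
       (\<forall>v\<in>F m. \<forall>w\<in>F m. \<forall>i. \<phi> m (v + w) i = \<phi> m v i + \<phi> m w i) \<and>
       (\<forall>a. \<forall>v\<in>F m. \<forall>i. \<phi> m (s a v) i = a * \<phi> m v i)))"

text \<open>A fibrewise map \<open>h\<close> is given, between two trivializations, by a matrix of smooth functions.\<close>

definition smooth_between ::
    "('m, 'e::real_normed_vector) manifold \<Rightarrow> ('m \<Rightarrow> 'v set) \<Rightarrow> ('m \<Rightarrow> 'v \<Rightarrow> 'w)
      \<Rightarrow> ('k::real_normed_field, 'm, 'v) triv \<Rightarrow> ('k, 'm, 'w) triv \<Rightarrow> bool" where
  "smooth_between M F h = (\<lambda>(U, n, \<phi>) (V, k, \<psi>).
     \<exists>g. (\<forall>i j. smooth_fun_on M (U \<inter> V) (g i j)) \<and>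
       (\<forall>m\<in>U \<inter> V. \<forall>v\<in>F m. \<forall>i<k. \<psi> m (h m v) i = (\<Sum>j<n. g i j m * \<phi> m v j)))"

definition vector_bundle ::
    "('m, 'e::real_normed_vector) manifold \<Rightarrow> ('k::real_normed_field, 'm, 'v::ab_group_add) vbundle
      \<Rightarrow> bool" where
  "vector_bundle M E \<longleftrightarrow>
     vector_space (scl E) \<and>
     (\<forall>m\<in>points M. module.subspace (scl E) (fibre E m)) \<and>
     (\<forall>t\<in>trivs E. local_triv M (fibre E) (scl E) t) \<and>
     (\<forall>m\<in>points M. \<exists>t\<in>trivs E. m \<in> fst t) \<and>
     (\<forall>t\<in>trivs E. \<forall>t'\<in>trivs E. smooth_between M (fibre E) (\<lambda>m v. v) t t')"

definition bundle_map ::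
    "('m, 'e::real_normed_vector) manifold \<Rightarrow> ('k::real_normed_field, 'm, 'v::ab_group_add) vbundle
      \<Rightarrow> ('k, 'm, 'w::ab_group_add) vbundle \<Rightarrow> ('m \<Rightarrow> 'v \<Rightarrow> 'w) \<Rightarrow> bool" where
  "bundle_map M E E' h \<longleftrightarrow>
     (\<forall>m\<in>points M. \<forall>v\<in>fibre E m.
        h m v \<in> fibre E' m \<and>
        (\<forall>w\<in>fibre E m. h m (v + w) = h m v + h m w) \<and>
        (\<forall>a. h m (scl E a v) = scl E' a (h m v))) \<and>
     (\<forall>t\<in>trivs E. \<forall>t'\<in>trivs E'. smooth_between M (fibre E) h t t')"

definition smooth_section_on ::
    "('m, 'e::real_normed_vector) manifold \<Rightarrow> ('k::real_normed_field, 'm, 'v) vbundle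
      \<Rightarrow> 'm set \<Rightarrow> ('m \<Rightarrow> 'v) \<Rightarrow> bool" where
  "smooth_section_on M E W s \<longleftrightarrow>
     (\<forall>m\<in>W. s m \<in> fibre E m) \<and>
     (\<forall>(U, n, \<phi>)\<in>trivs E. \<forall>i<n. smooth_fun_on M (U \<inter> W) (\<lambda>m. \<phi> m (s m) i))"

text \<open>Global sections are normalized to vanish off the manifold, so that equality of functions is
  equality of sections.\<close>

definition sections ::
    "('m, 'e::real_normed_vector) manifold \<Rightarrow> ('k::real_normed_field, 'm, 'v::ab_group_add) vbundle
      \<Rightarrow> ('m \<Rightarrow> 'v) set" where
  "sections M E = {s. smooth_section_on M E (points M) s \<and> (\<forall>m. m \<notin> points M \<longrightarrow> s m = 0)}"

text \<open>The complexification: \<open>(u, v)\<close> stands for \<open>u \<otimes> 1 + v \<otimes> \<i>\<close>.\<close>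

definition complexify :: "(real, 'm, 'v::ab_group_add) vbundle \<Rightarrow> (complex, 'm, 'v \<times> 'v) vbundle" where
  "complexify E =
    \<lparr> fibre = (\<lambda>m. fibre E m \<times> fibre E m),
      scl = (\<lambda>z (u, v). (scl E (Re z) u - scl E (Im z) v, scl E (Re z) v + scl E (Im z) u)),
      trivs = {(U, n, \<lambda>m (u, v) i. Complex (\<phi> m u i) (\<phi> m v i)) | U n \<phi>. (U, n, \<phi>) \<in> trivs E} \<rparr>"

text \<open>The structure induced on a family \<open>F\<close> of real subspaces of the fibres of a complex bundle:
  all local trivializations of \<open>F\<close> whose local frames are smooth as local sections of \<open>E\<close>. It is
  defined for every \<open>F\<close>, but is a vector bundle only if enough such trivializations exist.\<close>

definition real_subbundle ::
    "('m, 'e::real_normed_vector) manifold \<Rightarrow> (complex, 'm, 'v::ab_group_add) vbundle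
      \<Rightarrow> ('m \<Rightarrow> 'v set) \<Rightarrow> (real, 'm, 'v) vbundle" where
  "real_subbundle M E F =
    \<lparr> fibre = F,
      scl = (\<lambda>r. scl E (complex_of_real r)),
      trivs = {(U, n, \<phi>). local_triv M F (\<lambda>r. scl E (complex_of_real r)) (U, n, \<phi>) \<and>
        (\<forall>j<n. smooth_section_on M E U
           (\<lambda>m. inv_into (F m) (\<phi> m) (\<lambda>i. if i = j then 1 else 0)))} \<rparr>"


section \<open>Tangent bundle and Lie bracket\<close>

text \<open>A tangent vector at \<open>m\<close> is a family of coordinate representations, one for each chart around
  \<open>m\<close>, related by the derivatives of the transition maps.\<close>

type_synonym ('m, 'e) tangent = "('m, 'e) chart \<Rightarrow> 'e"

definition tangent_space ::
    "('m, 'e::real_normed_vector) manifold \<Rightarrow> 'm \<Rightarrow> ('m, 'e) tangent set" where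
  "tangent_space M m = {v.
     (\<forall>c\<in>atlas M. \<forall>d\<in>atlas M. m \<in> fst c \<inter> fst d \<longrightarrow>
        v d = frechet_derivative (snd d \<circ> chart_inv c) (at (snd c m)) (v c)) \<and>
     (\<forall>c. \<not> (c \<in> atlas M \<and> m \<in> fst c) \<longrightarrow> v c = 0)}"

definition linear_coords :: "nat \<Rightarrow> ('e::real_normed_vector \<Rightarrow> nat \<Rightarrow> real) \<Rightarrow> bool" where
  "linear_coords n \<beta> \<longleftrightarrow> (\<forall>i. linear (\<lambda>x. \<beta> x i)) \<and> bij_betw \<beta> UNIV {y. \<forall>i\<ge>n. y i = 0}"

definition tangent_bundle ::
    "('m, 'e::real_normed_vector) manifold \<Rightarrow> (real, 'm, ('m, 'e) tangent) vbundle" where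
  "tangent_bundle M =
    \<lparr> fibre = tangent_space M,
      scl = (\<lambda>r v c. r *\<^sub>R v c),
      trivs = {(fst c, n, \<lambda>m v. \<beta> (v c)) | c n \<beta>. c \<in> atlas M \<and> linear_coords n \<beta>} \<rparr>"

abbreviation complex_tangent_bundle ::
    "('m, 'e::real_normed_vector) manifold
      \<Rightarrow> (complex, 'm, ('m, 'e) tangent \<times> ('m, 'e) tangent) vbundle" where
  "complex_tangent_bundle M \<equiv> complexify (tangent_bundle M)"

text \<open>In coordinates, the bracket of \<open>X\<close> and \<open>Y\<close> is \<open>DY(X) - DX(Y)\<close>.\<close>

definition lie_bracket ::
    "('m, 'e::real_normed_vector) manifold \<Rightarrow> ('m \<Rightarrow> ('m, 'e) tangent) \<Rightarrow> ('m \<Rightarrow> ('m, 'e) tangent)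
      \<Rightarrow> 'm \<Rightarrow> ('m, 'e) tangent" where
  "lie_bracket M X Y = (\<lambda>m c.
     if c \<in> atlas M \<and> m \<in> fst c then
       frechet_derivative (\<lambda>x. Y (chart_inv c x) c) (at (snd c m)) (X m c)
       - frechet_derivative (\<lambda>x. X (chart_inv c x) c) (at (snd c m)) (Y m c)
     else 0)"

text \<open>The complex bilinear extension to sections of the complexified tangent bundle.\<close>

definition complex_lie_bracket ::
    "('m, 'e::real_normed_vector) manifold
      \<Rightarrow> ('m \<Rightarrow> ('m, 'e) tangent \<times> ('m, 'e) tangent) \<Rightarrow> ('m \<Rightarrow> ('m, 'e) tangent \<times> ('m, 'e) tangent)
      \<Rightarrow> 'm \<Rightarrow> ('m, 'e) tangent \<times> ('m, 'e) tangent" where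
  "complex_lie_bracket M Z W =
     (let X = fst \<circ> Z; X' = snd \<circ> Z; Y = fst \<circ> W; Y' = snd \<circ> W
      in (\<lambda>m. (lie_bracket M X Y m - lie_bracket M X' Y' m,
               lie_bracket M X Y' m + lie_bracket M X' Y m)))"

text \<open>\<open>L\<close> is a Lie subalgebra of the sections of \<open>E\<close> with respect to the bracket \<open>br\<close>.\<close>

definition lie_subalgebra ::
    "('m, 'e::real_normed_vector) manifold \<Rightarrow> ('k::real_normed_field, 'm, 'v::ab_group_add) vbundle
      \<Rightarrow> (('m \<Rightarrow> 'v) \<Rightarrow> ('m \<Rightarrow> 'v) \<Rightarrow> 'm \<Rightarrow> 'v) \<Rightarrow> ('m \<Rightarrow> 'v) set \<Rightarrow> bool" where
  "lie_subalgebra M E br L \<longleftrightarrow>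
     L \<subseteq> sections M E \<and>
     module.subspace (\<lambda>a X m. scl E a (X m)) L \<and>
     (\<forall>X\<in>L. \<forall>Y\<in>L. br X Y \<in> L)"


section \<open>Anchored vector bundles\<close>

definition complex_anchored_bundle ::
    "('m, 'e::real_normed_vector) manifold \<Rightarrow> (complex, 'm, 'v::ab_group_add) vbundle
      \<Rightarrow> ('m \<Rightarrow> 'v \<Rightarrow> ('m, 'e) tangent \<times> ('m, 'e) tangent) \<Rightarrow> bool" where
  "complex_anchored_bundle M A \<rho> \<longleftrightarrow>
     vector_bundle M A \<and> bundle_map M A (complex_tangent_bundle M) \<rho>"

definition real_anchored_bundle ::
    "('m, 'e::real_normed_vector) manifold \<Rightarrow> (real, 'm, 'v::ab_group_add) vbundle
      \<Rightarrow> ('m \<Rightarrow> 'v \<Rightarrow> ('m, 'e) tangent) \<Rightarrow> bool" where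
  "real_anchored_bundle M A \<rho> \<longleftrightarrow>
     vector_bundle M A \<and> bundle_map M A (tangent_bundle M) \<rho>"

definition anchor_image ::
    "('m, 'e::real_normed_vector) manifold \<Rightarrow> ('k::real_normed_field, 'm, 'v::ab_group_add) vbundle
      \<Rightarrow> ('m \<Rightarrow> 'v \<Rightarrow> 'w::ab_group_add) \<Rightarrow> ('m \<Rightarrow> 'w) set" where
  "anchor_image M A \<rho> = (\<lambda>s m. if m \<in> points M then \<rho> m (s m) else 0) ` sections M A"

definition complex_involutive ::
    "('m, 'e::real_normed_vector) manifold \<Rightarrow> (complex, 'm, 'v::ab_group_add) vbundle
      \<Rightarrow> ('m \<Rightarrow> 'v \<Rightarrow> ('m, 'e) tangent \<times> ('m, 'e) tangent) \<Rightarrow> bool" where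
  "complex_involutive M A \<rho> \<longleftrightarrow>
     lie_subalgebra M (complex_tangent_bundle M) (complex_lie_bracket M) (anchor_image M A \<rho>)"

definition real_involutive ::
    "('m, 'e::real_normed_vector) manifold \<Rightarrow> (real, 'm, 'v::ab_group_add) vbundle
      \<Rightarrow> ('m \<Rightarrow> 'v \<Rightarrow> ('m, 'e) tangent) \<Rightarrow> bool" where
  "real_involutive M A \<rho> \<longleftrightarrow>
     lie_subalgebra M (tangent_bundle M) (lie_bracket M) (anchor_image M A \<rho>)"

text \<open>The decomposition \<open>\<rho> = \<rho>\<^sub>1 + \<i> \<rho>\<^sub>2\<close>.\<close>

definition anchor1 :: "('m \<Rightarrow> 'v \<Rightarrow> 'w \<times> 'w) \<Rightarrow> 'm \<Rightarrow> 'v \<Rightarrow> 'w" where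
  "anchor1 \<rho> m v = fst (\<rho> m v)"

definition anchor2 :: "('m \<Rightarrow> 'v \<Rightarrow> 'w \<times> 'w) \<Rightarrow> 'm \<Rightarrow> 'v \<Rightarrow> 'w" where
  "anchor2 \<rho> m v = snd (\<rho> m v)"

definition re_fibre ::
    "(complex, 'm, 'v) vbundle \<Rightarrow> ('m \<Rightarrow> 'v \<Rightarrow> 'w::ab_group_add \<times> 'w) \<Rightarrow> 'm \<Rightarrow> 'v set" where
  "re_fibre A \<rho> m = {v \<in> fibre A m. anchor2 \<rho> m v = 0}"

definition real_rank ::
    "(complex, 'm, 'v::ab_group_add) vbundle \<Rightarrow> ('m \<Rightarrow> 'v \<Rightarrow> 'w::ab_group_add \<times> 'w) \<Rightarrow> 'm \<Rightarrow> nat" where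
  "real_rank A \<rho> m = vector_space.dim (\<lambda>r. scl A (complex_of_real r)) (re_fibre A \<rho> m)"

definition re_bundle ::
    "('m, 'e::real_normed_vector) manifold \<Rightarrow> (complex, 'm, 'v::ab_group_add) vbundle
      \<Rightarrow> ('m \<Rightarrow> 'v \<Rightarrow> 'w::ab_group_add \<times> 'w) \<Rightarrow> (real, 'm, 'v) vbundle" where
  "re_bundle M A \<rho> = real_subbundle M A (re_fibre A \<rho>)"

text \<open>The anchor \<open>\<rho>\<^sup>r\<^sup>e\<close> of \<open>re_bundle M A \<rho>\<close> is \<open>anchor1 \<rho>\<close>; the restriction to \<open>re_fibre A \<rho>\<close> is
  implicit, as only values on the fibres of the bundle matter.\<close>

abbreviation re_anchor :: "('m \<Rightarrow> 'v \<Rightarrow> 'w \<times> 'w) \<Rightarrow> 'm \<Rightarrow> 'v \<Rightarrow> 'w" where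
  "re_anchor \<rho> \<equiv> anchor1 \<rho>"

end

theory Submission
  imports Defs
begin

text \<open>Write \<open>F\<close> for the family of kernels of \<open>\<rho>\<^sub>2\<close>. The involutivity of its anchor is a short argument once
\<open>F\<close> is known to be a bundle whose smooth sections are exactly the smooth sections of \<open>A\<close> with
values in \<open>F\<close>. Let \<open>X = \<rho>\<^sub>1 s\<close> and \<open>Y = \<rho>\<^sub>1 t\<close> for sections \<open>s\<close> and \<open>t\<close> of \<open>F\<close>. As sections of \<open>A\<close>
they satisfy \<open>\<rho> s = X\<close> and \<open>\<rho> t = Y\<close>, without imaginary part, so the complex bracket of these
fields is the real field \<open>[X, Y]\<close> (\<open>complex_lie_bracket_of_real\<close>). The involutivity of \<open>A\<close> provides a smooth section \<open>u\<close>
of \<open>A\<close> with \<open>\<rho> u = [X, Y]\<close>. Its imaginary part vanishes, so \<open>u\<close> has values in \<open>F\<close>; hence \<open>u\<close> is a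
smooth section of \<open>F\<close>, and \<open>\<rho>\<^sub>1 u = [X, Y]\<close>.

The work lies in the bundle structure of \<open>F\<close>. Locally \<open>F\<close> is the common kernel of finitely many
smooth real-linear functionals on the fibres of \<open>A\<close>, the coordinates of \<open>\<rho>\<^sub>2\<close> in a chart
(\<open>re_fibre_kernel\<close>). An elimination procedure produces smooth sections that span the kernel at a given
point and span a space containing it nearby; when the rank is constant they are a frame of \<open>F\<close>
(\<open>constant_rank_kernel_frame\<close>). That different frames are related by smooth functions, and that
smoothness in \<open>F\<close> and in \<open>A\<close> agree, both follow from the existence of smooth functionals dual to
a frame (\<open>dual_functionals\<close>). Both constructions use sections and functionals instead of matrices, and
need no more than that a smooth function which is nonzero at a point can be divided by near it.\<close>

section \<open>Smooth functions on open sets of a normed space\<close>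

lemma diff_times_on_Suc_imp: "diff_times_on (Suc k) S f \<Longrightarrow> diff_times_on k S f"
proof (induction k arbitrary: f)
  case 0
  then show ?case
    by (auto intro!: continuous_at_imp_continuous_on differentiable_imp_continuous_within)
next
  case (Suc k)
  then show ?case by (metis diff_times_on.simps(2))
qed

lemma diff_times_on_cong:
  assumes "diff_times_on k S f" "open S" "\<And>x. x \<in> S \<Longrightarrow> f x = g x"
  shows "diff_times_on k S g"
  using assms
proof (induction k arbitrary: f g)
  case 0
  then show ?case using continuous_on_cong by force
next
  case (Suc k)
  have f: "f differentiable (at x)" if "x \<in> S" for x using Suc.prems that by simp
  have "g differentiable (at x)" if x: "x \<in> S" for x
  proof -
    obtain D where "(f has_derivative D) (at x)" using f[OF x] by (auto simp: differentiable_def)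
    then have "(g has_derivative D) (at x)"
      by (rule has_derivative_transform_within_open[OF _ Suc.prems(2) x]) (rule Suc.prems(3))
    then show ?thesis by (auto simp: differentiable_def)
  qed
  moreover have "diff_times_on k S (\<lambda>x. frechet_derivative g (at x) v)" for v
  proof (rule Suc.IH[of "\<lambda>x. frechet_derivative f (at x) v"])
    show "diff_times_on k S (\<lambda>x. frechet_derivative f (at x) v)" using Suc.prems by simp
    show "frechet_derivative f (at x) v = frechet_derivative g (at x) v" if "x \<in> S" for x
      by (rule fun_cong[OF frechet_derivative_transform_within_open[OF f Suc.prems(2)]])
         (use that Suc.prems(3) in blast)+
  qed (rule Suc.prems(2))
  ultimately show ?case by simp
qed

text \<open>Smoothness is defined through the \<^const>\<open>frechet_derivative\<close> of the function itself, which the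
derivative rules never produce syntactically; this introduction rule accepts any derivative that
has been computed by those rules, and the closure properties below become inductions on the order.\<close>

lemma diff_times_on_SucI:
  assumes "open S" "\<And>x. x \<in> S \<Longrightarrow> (f has_derivative D x) (at x)"
    and "\<And>v. diff_times_on k S (\<lambda>x. D x v)"
  shows "diff_times_on (Suc k) S f"
proof -
  have "diff_times_on k S (\<lambda>x. frechet_derivative f (at x) v)" for v
    by (rule diff_times_on_cong[OF assms(3,1)])
       (rule fun_cong[OF frechet_derivative_at[OF assms(2)]])
  with assms(2) show ?thesis by (auto simp: differentiable_def)
qed

lemma diff_times_on_has_derivative:
  "diff_times_on (Suc k) S f \<Longrightarrow> x \<in> S \<Longrightarrow> (f has_derivative frechet_derivative f (at x)) (at x)"
  by (simp add: frechet_derivative_works)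

lemma diff_times_on_subset: "diff_times_on k S f \<Longrightarrow> T \<subseteq> S \<Longrightarrow> diff_times_on k T f"
  by (induction k arbitrary: f) (auto intro: continuous_on_subset)

lemma diff_times_on_local:
  assumes "\<And>x. x \<in> S \<Longrightarrow> \<exists>T. open T \<and> x \<in> T \<and> diff_times_on k T f"
  shows "diff_times_on k S f"
  using assms
proof (induction k arbitrary: f)
  case 0
  have "isCont f x" if "x \<in> S" for x
    using 0[OF that] by (auto simp: continuous_on_eq_continuous_at)
  then show ?case by (simp add: continuous_at_imp_continuous_on)
next
  case (Suc k)
  then show ?case by (metis diff_times_on.simps(2))
qed

lemma diff_times_on_const: "diff_times_on k S (\<lambda>x. c)"
  by (induction k arbitrary: c) auto

lemma diff_times_on_bounded_linear:
  assumes "bounded_linear h" "open S" "diff_times_on k S f"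
  shows "diff_times_on k S (\<lambda>x. h (f x))"
  using assms(3)
proof (induction k arbitrary: f)
  case 0
  then show ?case using assms(1) by (simp add: bounded_linear.continuous_on)
next
  case (Suc k)
  note D = diff_times_on_has_derivative[OF Suc.prems]
  show ?case
    by (rule diff_times_on_SucI[OF assms(2) bounded_linear.has_derivative[OF assms(1) D]])
       (use Suc in auto)
qed

lemma diff_times_on_add:
  assumes "open S" "diff_times_on k S f" "diff_times_on k S g"
  shows "diff_times_on k S (\<lambda>x. f x + g x)"
  using assms(2,3)
proof (induction k arbitrary: f g)
  case 0
  then show ?case by (simp add: continuous_on_add)
next
  case (Suc k)
  note D = Suc.prems[THEN diff_times_on_has_derivative]
  show ?case
    by (rule diff_times_on_SucI[OF assms(1) has_derivative_add[OF D]]) (use Suc in auto)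
qed

lemma diff_times_on_mult:
  fixes f g :: "'e::real_normed_vector \<Rightarrow> 'f::real_normed_algebra"
  assumes "open S" "diff_times_on k S f" "diff_times_on k S g"
  shows "diff_times_on k S (\<lambda>x. f x * g x)"
  using assms(2,3)
proof (induction k arbitrary: f g)
  case 0
  then show ?case by (simp add: continuous_on_mult)
next
  case (Suc k)
  note D = Suc.prems[THEN diff_times_on_has_derivative]
  have fg: "diff_times_on k S f" "diff_times_on k S g"
    using Suc.prems diff_times_on_Suc_imp by blast+
  show ?case
    by (rule diff_times_on_SucI[OF assms(1) has_derivative_mult[OF D]])
       (use Suc fg in \<open>auto intro!: diff_times_on_add[OF assms(1)]\<close>)
qed

text \<open>The derivative \<open>- f\<^sup>-\<^sup>1 f' f\<^sup>-\<^sup>1\<close> involves the inverse only to the order already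
reached, so the product rule closes the induction.\<close>

lemma diff_times_on_inverse:
  fixes f :: "'e::real_normed_vector \<Rightarrow> 'f::real_normed_field"
  assumes "open S" "diff_times_on k S f" "\<And>x. x \<in> S \<Longrightarrow> f x \<noteq> 0"
  shows "diff_times_on k S (\<lambda>x. inverse (f x))"
  using assms(2)
proof (induction k)
  case 0
  then show ?case using assms(3) by (auto intro: continuous_on_inverse)
next
  case (Suc k)
  note D = diff_times_on_has_derivative[OF Suc.prems]
  have inv: "diff_times_on k S (\<lambda>x. inverse (f x))"
    using Suc diff_times_on_Suc_imp by blast
  have "diff_times_on k S (\<lambda>x. - (inverse (f x) * frechet_derivative f (at x) v * inverse (f x)))"
    for v
    using Suc.prems
    by (intro diff_times_on_bounded_linear[OF bounded_linear_minus[OF bounded_linear_ident]]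
          diff_times_on_mult assms(1) inv) auto
  then show ?case
    by (intro diff_times_on_SucI[OF assms(1) Deriv.has_derivative_inverse[OF assms(3) D]])
qed


section \<open>Smooth functions on open sets of a manifold\<close>

lemma openin_points: "openin (mtop M) W \<Longrightarrow> m \<in> W \<Longrightarrow> m \<in> points M"
  by (meson openin_subset subsetD)

context
  fixes M :: "('m, 'e::real_normed_vector) manifold"
  assumes mfd: "smooth_manifold M"
begin

lemma chart_facts:
  assumes "c \<in> atlas M"
  shows open_chart_dom: "openin (mtop M) (fst c)"
    and open_chart_ran: "open (snd c ` fst c)"
    and inj_chart: "inj_on (snd c) (fst c)"
    and continuous_chart:
      "continuous_map (subtopology (mtop M) (fst c)) (top_of_set (snd c ` fst c)) (snd c)"
    and open_map_chart:
      "open_map (subtopology (mtop M) (fst c)) (top_of_set (snd c ` fst c)) (snd c)"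
proof -
  have c: "is_chart (mtop M) c" using mfd assms by (auto simp: smooth_manifold_def)
  then show o: "openin (mtop M) (fst c)" "open (snd c ` fst c)" by (auto simp: is_chart_def)
  have "topspace (subtopology (mtop M) (fst c)) = fst c"
    using openin_subset[OF o(1)] by auto
  moreover have
    h: "homeomorphic_map (subtopology (mtop M) (fst c)) (top_of_set (snd c ` fst c)) (snd c)"
    using c by (auto simp: is_chart_def)
  ultimately show "inj_on (snd c) (fst c)" using homeomorphic_imp_injective_map by metis
  show "continuous_map (subtopology (mtop M) (fst c)) (top_of_set (snd c ` fst c)) (snd c)"
    "open_map (subtopology (mtop M) (fst c)) (top_of_set (snd c ` fst c)) (snd c)"
    using h homeomorphic_imp_continuous_map homeomorphic_imp_open_map by blast+
qed

lemma chart_inv_chart: "c \<in> atlas M \<Longrightarrow> m \<in> fst c \<Longrightarrow> chart_inv c (snd c m) = m"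
  by (simp add: inj_chart)

lemma chart_exists:
  assumes "m \<in> points M"
  obtains c where "c \<in> atlas M" "m \<in> fst c"
  using assms mfd by (auto simp: smooth_manifold_def)

lemma open_chart_image:
  assumes "c \<in> atlas M" "openin (mtop M) W"
  shows "open (snd c ` (fst c \<inter> W))"
proof -
  have "openin (subtopology (mtop M) (fst c)) (fst c \<inter> W)"
    using assms(2) by (auto simp: openin_subtopology)
  then have "openin (top_of_set (snd c ` fst c)) (snd c ` (fst c \<inter> W))"
    using open_map_chart[OF assms(1)] by (auto simp: open_map_def)
  then show ?thesis using open_chart_ran[OF assms(1)] by (simp add: openin_open_eq)
qed

lemma smooth_fun_on_subset: "smooth_fun_on M W f \<Longrightarrow> W' \<subseteq> W \<Longrightarrow> smooth_fun_on M W' f"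
  unfolding smooth_fun_on_def smooth_on_def
  by (meson Int_mono diff_times_on_subset image_mono subset_refl)

lemma smooth_fun_on_cong:
  assumes "smooth_fun_on M W f" "openin (mtop M) W" "\<And>m. m \<in> W \<Longrightarrow> f m = g m"
  shows "smooth_fun_on M W g"
  unfolding smooth_fun_on_def smooth_on_def
proof (intro ballI allI)
  fix c k assume c: "c \<in> atlas M"
  show "diff_times_on k (snd c ` (fst c \<inter> W)) (g \<circ> chart_inv c)"
    by (rule diff_times_on_cong[of _ _ "f \<circ> chart_inv c"])
       (use assms c in \<open>auto simp: smooth_fun_on_def smooth_on_def open_chart_image chart_inv_chart\<close>)
qed

lemma smooth_fun_on_local:
  assumes "\<And>m. m \<in> W \<Longrightarrow> \<exists>W'. openin (mtop M) W' \<and> m \<in> W' \<and> smooth_fun_on M W' f"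
  shows "smooth_fun_on M W f"
  unfolding smooth_fun_on_def smooth_on_def
proof (intro ballI allI diff_times_on_local)
  fix c k x assume c: "c \<in> atlas M" and "x \<in> snd c ` (fst c \<inter> W)"
  then obtain m where m: "m \<in> fst c" "m \<in> W" "x = snd c m" by auto
  obtain W' where "openin (mtop M) W'" "m \<in> W'" "smooth_fun_on M W' f" using assms m by blast
  then show "\<exists>T. open T \<and> x \<in> T \<and> diff_times_on k T (f \<circ> chart_inv c)"
    using m c open_chart_image
    by (intro exI[of _ "snd c ` (fst c \<inter> W')"]) (auto simp: smooth_fun_on_def smooth_on_def)
qed

text \<open>Since smoothness is tested in every chart separately, each closure property on the manifold is the
one on an open subset of the model space, and no chart transition is involved.\<close>

lemma smooth_fun_on_iff:
  "smooth_fun_on M W f \<longleftrightarrow>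
    (\<forall>c k. c \<in> atlas M \<longrightarrow> diff_times_on k (snd c ` (fst c \<inter> W)) (\<lambda>x. f (chart_inv c x)))"
  by (auto simp: smooth_fun_on_def smooth_on_def comp_def)

lemma smooth_fun_on_const: "smooth_fun_on M W (\<lambda>m. c)"
  by (simp add: smooth_fun_on_iff diff_times_on_const)

lemma smooth_fun_on_bounded_linear:
  "bounded_linear h \<Longrightarrow> openin (mtop M) W \<Longrightarrow> smooth_fun_on M W f \<Longrightarrow>
    smooth_fun_on M W (\<lambda>m. h (f m))"
  unfolding smooth_fun_on_iff by (intro allI impI, rule diff_times_on_bounded_linear) (auto intro: open_chart_image)

lemma smooth_fun_on_add:
  "openin (mtop M) W \<Longrightarrow> smooth_fun_on M W f \<Longrightarrow> smooth_fun_on M W g \<Longrightarrow>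
    smooth_fun_on M W (\<lambda>m. f m + g m)"
  unfolding smooth_fun_on_iff by (intro allI impI, rule diff_times_on_add) (auto intro: open_chart_image)

lemma smooth_fun_on_mult:
  fixes f g :: "'m \<Rightarrow> 'f::real_normed_algebra"
  shows "openin (mtop M) W \<Longrightarrow> smooth_fun_on M W f \<Longrightarrow> smooth_fun_on M W g \<Longrightarrow>
    smooth_fun_on M W (\<lambda>m. f m * g m)"
  unfolding smooth_fun_on_iff by (intro allI impI, rule diff_times_on_mult) (auto intro: open_chart_image)

lemma smooth_fun_on_sum:
  assumes "openin (mtop M) W" "\<And>i. i \<in> I \<Longrightarrow> smooth_fun_on M W (f i)"
  shows "smooth_fun_on M W (\<lambda>m. \<Sum>i\<in>I. f i m)"
  using assms(2)
  by (induction I rule: infinite_finite_induct)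
     (auto intro: smooth_fun_on_const smooth_fun_on_add[OF assms(1)])

lemma smooth_fun_on_uminus:
  "openin (mtop M) W \<Longrightarrow> smooth_fun_on M W f \<Longrightarrow> smooth_fun_on M W (\<lambda>m. - f m)"
  by (rule smooth_fun_on_bounded_linear[OF bounded_linear_minus[OF bounded_linear_ident]])

lemma smooth_fun_on_inverse:
  fixes f :: "'m \<Rightarrow> 'f::real_normed_field"
  assumes "openin (mtop M) W" "smooth_fun_on M W f" "\<And>m. m \<in> W \<Longrightarrow> f m \<noteq> 0"
  shows "smooth_fun_on M W (\<lambda>m. inverse (f m))"
  unfolding smooth_fun_on_iff
proof (intro allI impI diff_times_on_inverse)
  fix c k assume c: "c \<in> atlas M"
  show "open (snd c ` (fst c \<inter> W))" using c assms open_chart_image by blast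
  show "diff_times_on k (snd c ` (fst c \<inter> W)) (\<lambda>x. f (chart_inv c x))"
    using c assms by (simp add: smooth_fun_on_iff)
  show "\<And>x. x \<in> snd c ` (fst c \<inter> W) \<Longrightarrow> f (chart_inv c x) \<noteq> 0"
    using c assms by (auto simp: chart_inv_chart)
qed

text \<open>A division that is possible at one point is therefore possible, and smooth, on a neighbourhood.\<close>

lemma open_nonzero_set:
  fixes f :: "'m \<Rightarrow> 'f::real_normed_vector"
  assumes "openin (mtop M) W" "smooth_fun_on M W f"
  shows "openin (mtop M) {m \<in> W. f m \<noteq> 0}"
proof (subst openin_subopen, intro ballI)
  fix m assume "m \<in> {m \<in> W. f m \<noteq> 0}"
  then have m: "m \<in> W" "f m \<noteq> 0" by auto
  obtain c where c: "c \<in> atlas M" "m \<in> fst c" using chart_exists openin_points[OF assms(1) m(1)] .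
  define S where "S = {x \<in> snd c ` (fst c \<inter> W). (f \<circ> chart_inv c) x \<noteq> 0}"
  have "diff_times_on 0 (snd c ` (fst c \<inter> W)) (f \<circ> chart_inv c)"
    using assms c by (simp add: smooth_fun_on_def smooth_on_def del: diff_times_on.simps)
  then have "open ((snd c ` (fst c \<inter> W)) \<inter> (f \<circ> chart_inv c) -` (- {0}))"
    by (intro continuous_open_preimage open_chart_image[OF c(1) assms(1)]) (auto simp: open_Compl)
  then have "open S" by (auto simp: S_def vimage_def Int_def)
  then have "openin (top_of_set (snd c ` fst c)) S" by (auto simp: S_def openin_open)
  then have "openin (subtopology (mtop M) (fst c))
      {p \<in> topspace (subtopology (mtop M) (fst c)). snd c p \<in> S}"
    using openin_continuous_map_preimage continuous_chart[OF c(1)] by blast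
  then have "openin (mtop M) {p \<in> topspace (subtopology (mtop M) (fst c)). snd c p \<in> S}"
    using open_chart_dom[OF c(1)] openin_trans_full by blast
  moreover have "{p \<in> topspace (subtopology (mtop M) (fst c)). snd c p \<in> S}
      = {p \<in> fst c \<inter> W. f p \<noteq> 0}"
    using openin_subset[OF open_chart_dom[OF c(1)]] inj_chart[OF c(1)]
    by (auto simp: S_def chart_inv_chart[OF c(1)] dest: inj_onD)
  ultimately show "\<exists>T. openin (mtop M) T \<and> m \<in> T \<and> T \<subseteq> {m \<in> W. f m \<noteq> 0}"
    using m c by (intro exI[of _ "{p \<in> fst c \<inter> W. f p \<noteq> 0}"]) auto
qed

end


section \<open>Local sections of a vector bundle\<close>

abbreviation unit_tuple :: "nat \<Rightarrow> nat \<Rightarrow> 'k::zero_neq_one" where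
  "unit_tuple j \<equiv> (\<lambda>i. if i = j then 1 else 0)"

lemma local_triv_open: "local_triv M F s (U, n, \<phi>) \<Longrightarrow> openin (mtop M) U"
  by (simp add: local_triv_def)

context
  fixes M :: "('m, 'e::real_normed_vector) manifold"
    and F :: "'m \<Rightarrow> 'v::ab_group_add set" and s :: "'k::real_normed_field \<Rightarrow> 'v \<Rightarrow> 'v" and U n \<phi> m
  assumes triv: "local_triv M F s (U, n, \<phi>)" and m: "m \<in> U"
    and vs: "vector_space s" and sub: "module.subspace s (F m)"
begin

interpretation vector_space s by (rule vs)

lemma triv_bij: "bij_betw (\<phi> m) (F m) {x. \<forall>i\<ge>n. x i = 0}"
  and triv_add: "v \<in> F m \<Longrightarrow> w \<in> F m \<Longrightarrow> \<phi> m (v + w) i = \<phi> m v i + \<phi> m w i"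
  and triv_scale: "v \<in> F m \<Longrightarrow> \<phi> m (s a v) i = a * \<phi> m v i"
  using triv m by (auto simp: local_triv_def)

lemma triv_zero: "\<phi> m 0 i = 0"
  using triv_scale[of 0 0 i] subspace_0[OF sub] by simp

lemma triv_eqI:
  assumes "v \<in> F m" "w \<in> F m" "\<And>i. i < n \<Longrightarrow> \<phi> m v i = \<phi> m w i"
  shows "v = w"
proof -
  have "\<phi> m v = \<phi> m w"
    using assms bij_betwE[OF triv_bij] by (intro ext) (metis (mono_tags, lifting) mem_Collect_eq not_le)
  then show ?thesis using triv_bij assms by (auto simp: bij_betw_def dest: inj_onD)
qed

lemma triv_sum:
  assumes "\<And>j. j \<in> J \<Longrightarrow> f j \<in> F m"
  shows "\<phi> m (\<Sum>j\<in>J. s (x j) (f j)) i = (\<Sum>j\<in>J. x j * \<phi> m (f j) i)"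
  using assms
proof (induction J rule: infinite_finite_induct)
  case (insert j J)
  have "(\<Sum>j\<in>J. s (x j) (f j)) \<in> F m" using insert.prems by (auto intro!: subspace_sum subspace_scale sub)
  then show ?case using insert subspace_scale[OF sub] by (simp add: triv_add triv_scale)
qed (simp_all add: triv_zero)

lemma triv_frame:
  assumes "j < n"
  shows triv_frame_mem: "inv_into (F m) (\<phi> m) (unit_tuple j) \<in> F m"
    and triv_frame_coord: "\<phi> m (inv_into (F m) (\<phi> m) (unit_tuple j)) = unit_tuple j"
proof -
  have "unit_tuple j \<in> \<phi> m ` F m"
    using triv_bij assms by (auto simp: bij_betw_def)
  then show "inv_into (F m) (\<phi> m) (unit_tuple j) \<in> F m"
    "\<phi> m (inv_into (F m) (\<phi> m) (unit_tuple j)) = unit_tuple j"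
    by (auto intro: inv_into_into f_inv_into_f)
qed

text \<open>The preimages of the unit tuples form the frame belonging to a trivialization.\<close>

lemma triv_expand:
  assumes "v \<in> F m"
  shows "(\<Sum>j<n. s (\<phi> m v j) (inv_into (F m) (\<phi> m) (unit_tuple j))) = v"
proof (rule triv_eqI)
  show "(\<Sum>j<n. s (\<phi> m v j) (inv_into (F m) (\<phi> m) (unit_tuple j))) \<in> F m"
    by (auto intro!: subspace_sum subspace_scale sub triv_frame_mem)
  fix i assume i: "i < n"
  have "\<phi> m (\<Sum>j<n. s (\<phi> m v j) (inv_into (F m) (\<phi> m) (unit_tuple j))) i
      = (\<Sum>j<n. \<phi> m v j * unit_tuple j i)"
    by (subst triv_sum) (auto simp: triv_frame_mem triv_frame_coord)
  also have "\<dots> = \<phi> m v i" using i by (simp add: if_distrib cong: if_cong)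
  finally show "\<phi> m (\<Sum>j<n. s (\<phi> m v j) (inv_into (F m) (\<phi> m) (unit_tuple j))) i = \<phi> m v i" .
qed fact

end

lemma smooth_betweenE:
  assumes "smooth_between M F h (U, n, \<phi>) (V, k, \<psi>)"
  obtains g where "\<And>i j. smooth_fun_on M (U \<inter> V) (g i j)"
    and "\<And>m v i. m \<in> U \<Longrightarrow> m \<in> V \<Longrightarrow> v \<in> F m \<Longrightarrow> i < k \<Longrightarrow>
      \<psi> m (h m v) i = (\<Sum>j<n. g i j m * \<phi> m v j)"
  using assms unfolding smooth_between_def prod.case by (metis IntI)

lemma smooth_section_onI:
  assumes "\<And>m. m \<in> W \<Longrightarrow> s m \<in> fibre E m"
    and "\<And>U n \<phi> i. (U, n, \<phi>) \<in> trivs E \<Longrightarrow> i < n \<Longrightarrow> smooth_fun_on M (U \<inter> W) (\<lambda>m. \<phi> m (s m) i)"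
  shows "smooth_section_on M E W s"
  using assms by (auto simp: smooth_section_on_def)

lemma smooth_section_onD:
  assumes "smooth_section_on M E W s"
  shows smooth_section_mem: "m \<in> W \<Longrightarrow> s m \<in> fibre E m"
    and smooth_section_coord:
      "(U, n, \<phi>) \<in> trivs E \<Longrightarrow> i < n \<Longrightarrow> smooth_fun_on M (U \<inter> W) (\<lambda>m. \<phi> m (s m) i)"
  using assms by (auto simp: smooth_section_on_def)

lemma smooth_section_on_subset:
  assumes "smooth_manifold M" "smooth_section_on M E W s" "W' \<subseteq> W"
  shows "smooth_section_on M E W' s"
proof (rule smooth_section_onI)
  show "s m \<in> fibre E m" if "m \<in> W'" for m
    using assms(3) that smooth_section_mem[OF assms(2)] by blast
  show "smooth_fun_on M (U \<inter> W') (\<lambda>m. \<phi> m (s m) i)" if "(U, n, \<phi>) \<in> trivs E" "i < n" for U n \<phi> i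
    by (rule smooth_fun_on_subset[OF assms(1) smooth_section_coord[OF assms(2) that]])
       (use assms(3) in blast)
qed

lemma smooth_section_on_local:
  assumes "smooth_manifold M" "\<forall>t\<in>trivs E. openin (mtop M) (fst t)"
    and "\<And>m. m \<in> W \<Longrightarrow> \<exists>W'. openin (mtop M) W' \<and> m \<in> W' \<and> smooth_section_on M E W' s"
  shows "smooth_section_on M E W s"
proof (rule smooth_section_onI)
  show "s m \<in> fibre E m" if "m \<in> W" for m using assms(3)[OF that] by (auto dest: smooth_section_mem)
  fix U n \<phi> i assume t: "(U, n, \<phi>) \<in> trivs E" "i < n"
  show "smooth_fun_on M (U \<inter> W) (\<lambda>m. \<phi> m (s m) i)"
  proof (rule smooth_fun_on_local[OF assms(1)])
    fix m assume m: "m \<in> U \<inter> W"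
    then obtain W' where "openin (mtop M) W'" "m \<in> W'" "smooth_section_on M E W' s"
      using assms(3) by blast
    then show "\<exists>W'. openin (mtop M) W' \<and> m \<in> W' \<and> smooth_fun_on M W' (\<lambda>m. \<phi> m (s m) i)"
      using m t assms(2) smooth_section_coord by (intro exI[of _ "U \<inter> W'"]) fastforce
  qed
qed

lemma smooth_section_on_cong:
  assumes "smooth_manifold M" "\<forall>t\<in>trivs E. openin (mtop M) (fst t)"
    and "smooth_section_on M E W s" "openin (mtop M) W" "\<And>m. m \<in> W \<Longrightarrow> s m = s' m"
  shows "smooth_section_on M E W s'"
proof (rule smooth_section_onI)
  show "s' m \<in> fibre E m" if "m \<in> W" for m
    using smooth_section_mem[OF assms(3) that] assms(5)[OF that] by simp
  fix U n \<phi> i assume t: "(U, n, \<phi>) \<in> trivs E" "i < n"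
  show "smooth_fun_on M (U \<inter> W) (\<lambda>m. \<phi> m (s' m) i)"
    by (rule smooth_fun_on_cong[OF assms(1) smooth_section_coord[OF assms(3) t]])
       (use assms t in \<open>fastforce+\<close>)
qed

locale smooth_bundle =
  fixes M :: "('m, 'e::real_normed_vector) manifold"
    and E :: "('k::real_normed_field, 'm, 'v::ab_group_add) vbundle"
  assumes mfd: "smooth_manifold M" and vb: "vector_bundle M E"
begin

sublocale vector_space "scl E"
  using vb by (simp add: vector_bundle_def)

lemma fibre_subspace: "m \<in> points M \<Longrightarrow> subspace (fibre E m)"
  and is_triv: "t \<in> trivs E \<Longrightarrow> local_triv M (fibre E) (scl E) t"
  and transition:
    "t \<in> trivs E \<Longrightarrow> t' \<in> trivs E \<Longrightarrow> smooth_between M (fibre E) (\<lambda>m v. v) t t'"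
  using vb by (auto simp: vector_bundle_def)

lemma triv_exists:
  assumes "m \<in> points M"
  obtains U n \<phi> where "(U, n, \<phi>) \<in> trivs E" "m \<in> U"
proof -
  have "\<exists>t\<in>trivs E. m \<in> fst t" using assms vb unfolding vector_bundle_def by blast
  then show ?thesis using that by force
qed

lemma triv_dom_open: "(U, n, \<phi>) \<in> trivs E \<Longrightarrow> openin (mtop M) U"
  using is_triv local_triv_open by blast

lemma triv_doms_open: "\<forall>t\<in>trivs E. openin (mtop M) (fst t)"
  using triv_dom_open by force

lemma triv_dom_points: "(U, n, \<phi>) \<in> trivs E \<Longrightarrow> m \<in> U \<Longrightarrow> m \<in> points M"
  by (rule openin_points[OF triv_dom_open])

context
  fixes U n \<phi> m
  assumes t: "(U, n, \<phi>) \<in> trivs E" and m: "m \<in> U"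
begin

lemmas triv_prems = is_triv[OF t] m vector_space_axioms fibre_subspace[OF triv_dom_points[OF t m]]
lemmas coord_zero = triv_zero[OF triv_prems]
lemmas coord_add = triv_add[OF triv_prems]
lemmas coord_scale = triv_scale[OF triv_prems]
lemmas coord_eqI = triv_eqI[OF triv_prems]
lemmas coord_sum = triv_sum[OF triv_prems]
lemmas frame_mem = triv_frame_mem[OF triv_prems]
lemmas frame_coord = triv_frame_coord[OF triv_prems]
lemmas frame_expand = triv_expand[OF triv_prems]

end

lemmas section_subset = smooth_section_on_subset[OF mfd]

lemma section_local:
  "(\<And>m. m \<in> W \<Longrightarrow> \<exists>W'. openin (mtop M) W' \<and> m \<in> W' \<and> smooth_section_on M E W' s) \<Longrightarrow>
    smooth_section_on M E W s"
  by (rule smooth_section_on_local[OF mfd triv_doms_open])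

lemma section_cong:
  assumes "smooth_section_on M E W s" "openin (mtop M) W" "\<And>m. m \<in> W \<Longrightarrow> s m = s' m"
  shows "smooth_section_on M E W s'"
  by (rule smooth_section_on_cong[OF mfd triv_doms_open assms])

lemma section_zero:
  assumes "openin (mtop M) W"
  shows "smooth_section_on M E W (\<lambda>m. 0)"
proof (rule smooth_section_onI)
  show "0 \<in> fibre E m" if "m \<in> W" for m
    by (rule subspace_0[OF fibre_subspace[OF openin_points[OF assms that]]])
  fix U n \<phi> i assume t: "(U, n, \<phi>) \<in> trivs E" "i < n"
  show "smooth_fun_on M (U \<inter> W) (\<lambda>m. \<phi> m 0 i)"
    by (rule smooth_fun_on_cong[OF mfd smooth_fun_on_const[OF mfd, of _ 0]])
       (use t assms in \<open>auto simp: triv_dom_open coord_zero[OF t(1)]\<close>)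
qed

lemma section_add:
  assumes "openin (mtop M) W" "smooth_section_on M E W s" "smooth_section_on M E W s'"
  shows "smooth_section_on M E W (\<lambda>m. s m + s' m)"
proof (rule smooth_section_onI)
  show "s m + s' m \<in> fibre E m" if "m \<in> W" for m
    using assms(2,3)[THEN smooth_section_mem, OF that]
    by (rule subspace_add[OF fibre_subspace[OF openin_points[OF assms(1) that]]])
  fix U n \<phi> i assume t: "(U, n, \<phi>) \<in> trivs E" "i < n"
  have "smooth_fun_on M (U \<inter> W) (\<lambda>m. \<phi> m (s m) i + \<phi> m (s' m) i)"
    using assms t by (intro smooth_fun_on_add[OF mfd] smooth_section_coord) (auto simp: triv_dom_open)
  then show "smooth_fun_on M (U \<inter> W) (\<lambda>m. \<phi> m (s m + s' m) i)"
    by (rule smooth_fun_on_cong[OF mfd])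
       (use t assms in \<open>auto simp: triv_dom_open coord_add[OF t(1)] smooth_section_mem\<close>)
qed

lemma section_scale:
  assumes "openin (mtop M) W" "smooth_fun_on M W a" "smooth_section_on M E W s"
  shows "smooth_section_on M E W (\<lambda>m. scl E (a m) (s m))"
proof (rule smooth_section_onI)
  show "scl E (a m) (s m) \<in> fibre E m" if "m \<in> W" for m
    using assms(3)[THEN smooth_section_mem, OF that]
    by (rule subspace_scale[OF fibre_subspace[OF openin_points[OF assms(1) that]]])
  fix U n \<phi> i assume t: "(U, n, \<phi>) \<in> trivs E" "i < n"
  have "smooth_fun_on M (U \<inter> W) (\<lambda>m. a m * \<phi> m (s m) i)"
    using assms t
    by (intro smooth_fun_on_mult[OF mfd] smooth_section_coord smooth_fun_on_subset[OF mfd assms(2)])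
       (auto simp: triv_dom_open)
  then show "smooth_fun_on M (U \<inter> W) (\<lambda>m. \<phi> m (scl E (a m) (s m)) i)"
    by (rule smooth_fun_on_cong[OF mfd])
       (use t assms in \<open>auto simp: triv_dom_open coord_scale[OF t(1)] smooth_section_mem\<close>)
qed

lemma section_sum:
  assumes "openin (mtop M) W" "\<And>j. j \<in> J \<Longrightarrow> smooth_section_on M E W (s j)"
  shows "smooth_section_on M E W (\<lambda>m. \<Sum>j\<in>J. s j m)"
  using assms(2)
  by (induction J rule: infinite_finite_induct)
     (auto intro: section_zero section_add assms(1))

text \<open>In a second trivialization the coordinates of the \<open>j\<close>-th frame vector are the \<open>j\<close>-th column of
the transition matrix.\<close>

lemma triv_frame_section:
  assumes t: "(U, n, \<phi>) \<in> trivs E" and j: "j < n"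
  shows "smooth_section_on M E U (\<lambda>m. inv_into (fibre E m) (\<phi> m) (unit_tuple j))"
proof (rule smooth_section_onI)
  show "inv_into (fibre E m) (\<phi> m) (unit_tuple j) \<in> fibre E m" if "m \<in> U" for m
    using frame_mem[OF t _ j] that by blast
  fix V k \<psi> i assume t': "(V, k, \<psi>) \<in> trivs E" "i < k"
  obtain g where g: "\<And>i j. smooth_fun_on M (U \<inter> V) (g i j)"
    "\<And>m v i. m \<in> U \<Longrightarrow> m \<in> V \<Longrightarrow> v \<in> fibre E m \<Longrightarrow> i < k \<Longrightarrow>
      \<psi> m v i = (\<Sum>l<n. g i l m * \<phi> m v l)"
    using smooth_betweenE[OF transition[OF t t'(1)]] by metis
  show "smooth_fun_on M (V \<inter> U) (\<lambda>m. \<psi> m (inv_into (fibre E m) (\<phi> m) (unit_tuple j)) i)"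
  proof (rule smooth_fun_on_cong[OF mfd, of _ "g i j"])
    show "smooth_fun_on M (V \<inter> U) (g i j)" using g(1) by (simp add: Int_commute[of V U])
    show "openin (mtop M) (V \<inter> U)" using t t' triv_dom_open by blast
    fix m assume m: "m \<in> V \<inter> U"
    then show "g i j m = \<psi> m (inv_into (fibre E m) (\<phi> m) (unit_tuple j)) i"
      using j t'(2) frame_mem[OF t _ j, of m] frame_coord[OF t _ j, of m]
      by (subst g(2)) (auto simp: if_distrib cong: if_cong)
  qed
qed

text \<open>Locally \<open>h s\<close> is the matrix of \<open>h\<close> applied to the coordinates of \<open>s\<close> in a trivialization of
\<open>E\<close>. The target \<open>E'\<close> is only asked for trivializations with open domains, the form in which the
tangent bundle and its complexification are at hand.\<close>

lemma bundle_map_section: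
  assumes h: "bundle_map M E E' h" and W: "openin (mtop M) W"
    and open': "\<forall>t\<in>trivs E'. openin (mtop M) (fst t)"
    and s: "smooth_section_on M E W s"
  shows "smooth_section_on M E' W (\<lambda>m. h m (s m))"
proof (rule smooth_section_onI)
  show "h m (s m) \<in> fibre E' m" if "m \<in> W" for m
    using h smooth_section_mem[OF s that] openin_points[OF W that] by (auto simp: bundle_map_def)
  fix V k \<psi> i assume t': "(V, k, \<psi>) \<in> trivs E'" "i < k"
  show "smooth_fun_on M (V \<inter> W) (\<lambda>m. \<psi> m (h m (s m)) i)"
  proof (rule smooth_fun_on_local[OF mfd])
    fix m assume m: "m \<in> V \<inter> W"
    then obtain U n \<phi> where t: "(U, n, \<phi>) \<in> trivs E" "m \<in> U"
      using triv_exists openin_points[OF W] by blast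
    have "smooth_between M (fibre E) h (U, n, \<phi>) (V, k, \<psi>)"
      using h t(1) t'(1) unfolding bundle_map_def by blast
    then obtain g where g: "\<And>i l. smooth_fun_on M (U \<inter> V) (g i l)"
      "\<And>m v i. m \<in> U \<Longrightarrow> m \<in> V \<Longrightarrow> v \<in> fibre E m \<Longrightarrow> i < k \<Longrightarrow>
        \<psi> m (h m v) i = (\<Sum>l<n. g i l m * \<phi> m v l)"
      by (rule smooth_betweenE) blast
    have "openin (mtop M) V" using open' t'(1) by force
    then have o: "openin (mtop M) (U \<inter> V \<inter> W)" using triv_dom_open[OF t(1)] W by blast
    have "smooth_fun_on M (U \<inter> V \<inter> W) (\<lambda>m. \<Sum>l<n. g i l m * \<phi> m (s m) l)"
    proof (intro smooth_fun_on_sum[OF mfd o] smooth_fun_on_mult[OF mfd o])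
      fix l assume "l \<in> {..<n}"
      then show "smooth_fun_on M (U \<inter> V \<inter> W) (\<lambda>m. \<phi> m (s m) l)"
        by (intro smooth_fun_on_subset[OF mfd smooth_section_coord[OF s t(1)]]) auto
      show "smooth_fun_on M (U \<inter> V \<inter> W) (g i l)" by (rule smooth_fun_on_subset[OF mfd g(1)]) blast
    qed
    then have "smooth_fun_on M (U \<inter> V \<inter> W) (\<lambda>m. \<psi> m (h m (s m)) i)"
      by (rule smooth_fun_on_cong[OF mfd _ o]) (use t' in \<open>simp add: g(2) smooth_section_mem[OF s]\<close>)
    then show "\<exists>W'. openin (mtop M) W' \<and> m \<in> W' \<and> smooth_fun_on M W' (\<lambda>m. \<psi> m (h m (s m)) i)"
      using o m t by blast
  qed
qed

end


section \<open>Real frames and real-linear functionals on a complex vector bundle\<close>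

text \<open>The kernel of the imaginary part of an anchor is closed under real but not under complex scalars.
Hence the linear algebra in the fibres of the complex bundle is done over the reals, where a local
frame has twice as many members.\<close>

locale complex_bundle = smooth_bundle M A
  for M :: "('m, 'e::real_normed_vector) manifold"
    and A :: "(complex, 'm, 'v::ab_group_add) vbundle"
begin

abbreviation real_scl :: "real \<Rightarrow> 'v \<Rightarrow> 'v" (infixr "\<cdot>" 75) where
  "r \<cdot> v \<equiv> scl A (complex_of_real r) v"

sublocale R: vector_space "\<lambda>r. scl A (complex_of_real r)"
  by unfold_locales (simp_all add: scale_right_distrib scale_left_distrib)

lemma fibre_R_subspace: "m \<in> points M \<Longrightarrow> R.subspace (fibre A m)"
  using fibre_subspace[of m] by (simp add: subspace_def R.subspace_def)

lemma section_real_scale: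
  assumes "openin (mtop M) W" "smooth_fun_on M W a" "smooth_section_on M A W s"
  shows "smooth_section_on M A W (\<lambda>m. a m \<cdot> s m)"
  by (rule section_scale[OF assms(1) smooth_fun_on_bounded_linear[OF mfd bounded_linear_of_real
          assms(1,2)] assms(3)])

text \<open>Independence is stated for families instead of sets, because the members of a frame move with the
base point while their index set stays the same.\<close>

definition independent_family :: "'i set \<Rightarrow> ('i \<Rightarrow> 'v) \<Rightarrow> bool" where
  "independent_family J f \<longleftrightarrow> (\<forall>x. (\<Sum>j\<in>J. x j \<cdot> f j) = 0 \<longrightarrow> (\<forall>j\<in>J. x j = 0))"

lemma independent_familyD:
  "independent_family J f \<Longrightarrow> (\<Sum>j\<in>J. x j \<cdot> f j) = 0 \<Longrightarrow> j \<in> J \<Longrightarrow> x j = 0"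
  by (simp add: independent_family_def)

text \<open>A smooth section over \<open>W\<close> of the real dual bundle. Its smoothness is tested on smooth sections and
not by coefficients, which makes the constructions below independent of trivializations. The
sections are allowed to live on smaller open sets, so that functionals can be restricted.\<close>

definition smooth_functional :: "'m set \<Rightarrow> ('m \<Rightarrow> 'v \<Rightarrow> real) \<Rightarrow> bool" where
  "smooth_functional W \<theta> \<longleftrightarrow>
     (\<forall>m\<in>W. \<forall>v\<in>fibre A m. (\<forall>w\<in>fibre A m. \<theta> m (v + w) = \<theta> m v + \<theta> m w) \<and>
       (\<forall>r. \<theta> m (r \<cdot> v) = r * \<theta> m v)) \<and>
     (\<forall>W' s. openin (mtop M) W' \<longrightarrow> W' \<subseteq> W \<longrightarrow> smooth_section_on M A W' s \<longrightarrow>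
       smooth_fun_on M W' (\<lambda>m. \<theta> m (s m)))"

lemma functional_subset: "smooth_functional W \<theta> \<Longrightarrow> W' \<subseteq> W \<Longrightarrow> smooth_functional W' \<theta>"
  unfolding smooth_functional_def by (meson subset_iff order_trans)

lemma
  assumes "smooth_functional W \<theta>"
  shows functional_add: "m \<in> W \<Longrightarrow> v \<in> fibre A m \<Longrightarrow> w \<in> fibre A m \<Longrightarrow> \<theta> m (v + w) = \<theta> m v + \<theta> m w"
    and functional_scale: "m \<in> W \<Longrightarrow> v \<in> fibre A m \<Longrightarrow> \<theta> m (r \<cdot> v) = r * \<theta> m v"
    and functional_smooth: "openin (mtop M) W' \<Longrightarrow> W' \<subseteq> W \<Longrightarrow> smooth_section_on M A W' s \<Longrightarrow>
      smooth_fun_on M W' (\<lambda>m. \<theta> m (s m))"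
  using assms unfolding smooth_functional_def by blast+

lemma functional_sum:
  assumes "smooth_functional W \<theta>" "m \<in> W" "m \<in> points M" "\<And>j. j \<in> J \<Longrightarrow> f j \<in> fibre A m"
  shows "\<theta> m (\<Sum>j\<in>J. x j \<cdot> f j) = (\<Sum>j\<in>J. x j * \<theta> m (f j))"
proof -
  note sub = fibre_R_subspace[OF assms(3)]
  have z: "\<theta> m 0 = 0"
    using functional_scale[OF assms(1,2) R.subspace_0[OF sub], of 0] by simp
  show ?thesis
    using assms(4)
  proof (induction J rule: infinite_finite_induct)
    case (insert j J)
    have "(\<Sum>j\<in>J. x j \<cdot> f j) \<in> fibre A m"
      using insert.prems by (auto intro!: R.subspace_sum R.subspace_scale sub)
    then show ?case
      using insert R.subspace_scale[OF sub]
      by (simp add: functional_add[OF assms(1,2)] functional_scale[OF assms(1,2)])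
  qed (simp_all add: z)
qed

lemma functional_lincomb:
  assumes W: "openin (mtop M) W"
    and \<pi>: "smooth_functional W \<pi>" and b: "smooth_fun_on M W b"
    and \<theta>: "\<And>j. j \<in> J \<Longrightarrow> smooth_functional W (\<theta> j)" and a: "\<And>j. j \<in> J \<Longrightarrow> smooth_fun_on M W (a j)"
  shows "smooth_functional W (\<lambda>m v. b m * \<pi> m v + (\<Sum>j\<in>J. a j m * \<theta> j m v))"
  unfolding smooth_functional_def
proof (intro conjI ballI allI impI)
  fix m v assume m: "m \<in> W" and v: "v \<in> fibre A m"
  show "b m * \<pi> m (v + w) + (\<Sum>j\<in>J. a j m * \<theta> j m (v + w))
      = b m * \<pi> m v + (\<Sum>j\<in>J. a j m * \<theta> j m v) + (b m * \<pi> m w + (\<Sum>j\<in>J. a j m * \<theta> j m w))"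
    if w: "w \<in> fibre A m" for w
    by (simp add: functional_add[OF \<pi> m v w] functional_add[OF \<theta> m v w] sum.distrib distrib_left)
  show "b m * \<pi> m (r \<cdot> v) + (\<Sum>j\<in>J. a j m * \<theta> j m (r \<cdot> v))
      = r * (b m * \<pi> m v + (\<Sum>j\<in>J. a j m * \<theta> j m v))" for r
    by (simp add: functional_scale[OF \<pi> m v] functional_scale[OF \<theta> m v] sum_distrib_left
        distrib_left mult.left_commute)
next
  fix W' s assume W': "openin (mtop M) W'" "W' \<subseteq> W" and s: "smooth_section_on M A W' s"
  show "smooth_fun_on M W' (\<lambda>m. b m * \<pi> m (s m) + (\<Sum>j\<in>J. a j m * \<theta> j m (s m)))"
    by (intro smooth_fun_on_add[OF mfd W'(1)] smooth_fun_on_sum[OF mfd W'(1)]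
        smooth_fun_on_mult[OF mfd W'(1)] functional_smooth[OF \<pi> W' s] functional_smooth[OF \<theta> W' s]
        smooth_fun_on_subset[OF mfd b W'(2)] smooth_fun_on_subset[OF mfd a W'(2)])
qed

lemma coordinate_functionals:
  assumes t: "(U, n, \<phi>) \<in> trivs A" and i: "i < n"
  shows "smooth_functional U (\<lambda>m v. Re (\<phi> m v i))" "smooth_functional U (\<lambda>m v. Im (\<phi> m v i))"
proof -
  have "smooth_functional U (\<lambda>m v. h (\<phi> m v i))"
    if h: "bounded_linear h" "\<And>r z. h (complex_of_real r * z) = r * h z" for h :: "complex \<Rightarrow> real"
    unfolding smooth_functional_def
  proof (intro conjI ballI allI impI)
    fix m v assume m: "m \<in> U" and v: "v \<in> fibre A m"
    show "h (\<phi> m (v + w) i) = h (\<phi> m v i) + h (\<phi> m w i)" if "w \<in> fibre A m" for w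
      using coord_add[OF t m v that] linear_add[OF bounded_linear.linear[OF h(1)]] by simp
    show "h (\<phi> m (r \<cdot> v) i) = r * h (\<phi> m v i)" for r
      using coord_scale[OF t m v] h(2) by simp
  next
    fix W' s assume W': "openin (mtop M) W'" "W' \<subseteq> U" and s: "smooth_section_on M A W' s"
    then have "smooth_fun_on M W' (\<lambda>m. \<phi> m (s m) i)"
      using smooth_section_coord[OF s t i] by (simp add: Int_absorb1)
    then show "smooth_fun_on M W' (\<lambda>m. h (\<phi> m (s m) i))"
      by (rule smooth_fun_on_bounded_linear[OF mfd h(1) W'(1)])
  qed
  from this[OF bounded_linear_Re] this[OF bounded_linear_Im]
  show "smooth_functional U (\<lambda>m v. Re (\<phi> m v i))" "smooth_functional U (\<lambda>m v. Im (\<phi> m v i))"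
    by simp_all
qed

lemma separating_functional:
  assumes m: "m \<in> points M" and v: "v \<in> fibre A m" "v \<noteq> 0"
  obtains U \<pi> where "openin (mtop M) U" "m \<in> U" "smooth_functional U \<pi>" "\<pi> m v \<noteq> 0"
proof -
  obtain U n \<phi> where t: "(U, n, \<phi>) \<in> trivs A" "m \<in> U" using triv_exists[OF m] .
  have "\<exists>i<n. \<phi> m v i \<noteq> 0"
  proof (rule ccontr)
    assume "\<not> (\<exists>i<n. \<phi> m v i \<noteq> 0)"
    then have "v = 0"
      using subspace_0[OF fibre_subspace[OF m]] v(1)
      by (intro coord_eqI[OF t]) (auto simp: coord_zero[OF t])
    with v(2) show False ..
  qed
  then obtain i where i: "i < n" "Re (\<phi> m v i) \<noteq> 0 \<or> Im (\<phi> m v i) \<noteq> 0"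
    by (auto simp: complex_eq_iff)
  then show thesis using that[OF triv_dom_open[OF t(1)] t(2)] coordinate_functionals[OF t(1) i(1)] by blast
qed

text \<open>Independent sections have smooth dual functionals near a point, by a Gram-Schmidt process that
needs divisions only. Let \<open>\<theta>\<close> be dual to the sections \<open>e j\<close> for \<open>j \<in> J\<close>, and let \<open>e a\<close> be a new
one. At \<open>m\<^sub>0\<close> the remainder \<open>r = e a - (\<Sum>j\<in>J. \<theta> j (e a) \<cdot> e j)\<close> does not vanish, so some smooth
functional \<open>\<pi>\<close> is nonzero on it. Making \<open>\<pi>\<close> vanish on the old sections and dividing by its value on
the remainder gives the new dual functional \<open>\<eta>\<close>, and the old ones are corrected by multiples of
\<open>\<eta>\<close> so that they vanish on \<open>e a\<close>.

These functionals extract the coefficients of a section with respect to a frame of a subbundle,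
which shows that the coefficients are smooth.\<close>

lemma dual_functionals:
  assumes "finite J" "openin (mtop M) W" "m\<^sub>0 \<in> W"
    and "\<And>j. j \<in> J \<Longrightarrow> smooth_section_on M A W (e j)"
    and "independent_family J (\<lambda>j. e j m\<^sub>0)"
  shows "\<exists>W' \<theta>. openin (mtop M) W' \<and> m\<^sub>0 \<in> W' \<and> W' \<subseteq> W \<and> (\<forall>i\<in>J. smooth_functional W' (\<theta> i)) \<and>
    (\<forall>m\<in>W'. \<forall>i\<in>J. \<forall>j\<in>J. \<theta> i m (e j m) = (if i = j then 1 else 0))"
  using assms(1,4,5)
proof (induction J rule: finite_induct)
  case empty
  then show ?case using assms(2,3) by (intro exI[of _ W]) auto
next
  case (insert a J)
  have "independent_family J (\<lambda>j. e j m\<^sub>0)"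
    unfolding independent_family_def
  proof (intro allI impI ballI)
    fix x j assume x: "(\<Sum>j\<in>J. x j \<cdot> e j m\<^sub>0) = 0" and j: "j \<in> J"
    have "(\<Sum>j\<in>insert a J. (if j = a then 0 else x j) \<cdot> e j m\<^sub>0) = (\<Sum>j\<in>J. x j \<cdot> e j m\<^sub>0)"
      using insert.hyps by (auto intro: sum.cong)
    with x have "(if j = a then 0 else x j) = 0"
      using independent_familyD[OF insert.prems(2), of "\<lambda>j. if j = a then 0 else x j" j] j by simp
    moreover have "j \<noteq> a" using j insert.hyps by blast
    ultimately show "x j = 0" by simp
  qed
  then have "\<exists>W' \<theta>. openin (mtop M) W' \<and> m\<^sub>0 \<in> W' \<and> W' \<subseteq> W \<and> (\<forall>i\<in>J. smooth_functional W' (\<theta> i)) \<and>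
      (\<forall>m\<in>W'. \<forall>i\<in>J. \<forall>j\<in>J. \<theta> i m (e j m) = (if i = j then 1 else 0))"
    by (intro insert.IH insert.prems(1)) auto
  then obtain W\<^sub>1 \<theta> where W1: "openin (mtop M) W\<^sub>1" "m\<^sub>0 \<in> W\<^sub>1" "W\<^sub>1 \<subseteq> W"
    and \<theta>: "\<And>i. i \<in> J \<Longrightarrow> smooth_functional W\<^sub>1 (\<theta> i)"
    and dual: "\<And>m i j. m \<in> W\<^sub>1 \<Longrightarrow> i \<in> J \<Longrightarrow> j \<in> J \<Longrightarrow> \<theta> i m (e j m) = (if i = j then 1 else 0)"
    by blast
  have m0: "m\<^sub>0 \<in> points M" using openin_points[OF assms(2,3)] .
  have mem: "e j m\<^sub>0 \<in> fibre A m\<^sub>0" if "j \<in> insert a J" for j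
    using smooth_section_mem[OF insert.prems(1)[OF that] assms(3)] .
  define x where "x j = (if j = a then 1 else - \<theta> j m\<^sub>0 (e a m\<^sub>0))" for j
  \<comment> \<open>the remainder, as a linear combination to which the independence of the family applies\<close>
  define r where "r = (\<Sum>j\<in>insert a J. x j \<cdot> e j m\<^sub>0)"
  have r: "r \<in> fibre A m\<^sub>0"
    using mem by (auto simp: r_def intro!: R.subspace_sum R.subspace_scale fibre_R_subspace m0)
  have "r \<noteq> 0"
    using independent_familyD[OF insert.prems(2), of x a] by (auto simp: r_def x_def)
  then obtain U \<pi> where U: "openin (mtop M) U" "m\<^sub>0 \<in> U" and \<pi>: "smooth_functional U \<pi>"
    and \<pi>r: "\<pi> m\<^sub>0 r \<noteq> 0" using separating_functional[OF m0 r] by blast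
  define W\<^sub>2 where "W\<^sub>2 = W\<^sub>1 \<inter> U"
  have W2: "openin (mtop M) W\<^sub>2" "W\<^sub>2 \<subseteq> W\<^sub>1" "W\<^sub>2 \<subseteq> U" "W\<^sub>2 \<subseteq> W" using W1 U by (auto simp: W\<^sub>2_def)
  have sec: "smooth_section_on M A W' (e j)" if "j \<in> insert a J" "W' \<subseteq> W" for j W'
    using section_subset[OF insert.prems(1)] that by blast
  \<comment> \<open>the value of \<open>\<pi>\<close> on the remainder, now as a function near \<open>m\<^sub>0\<close>\<close>
  define d where "d m = \<pi> m (e a m) + (\<Sum>j\<in>J. - \<theta> j m (e a m) * \<pi> m (e j m))" for m
  have d: "smooth_fun_on M W\<^sub>2 d"
    unfolding d_def using W2 sec
    by (intro smooth_fun_on_add[OF mfd W2(1)] smooth_fun_on_sum[OF mfd W2(1)]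
        smooth_fun_on_mult[OF mfd W2(1)] smooth_fun_on_uminus[OF mfd W2(1)]
        functional_smooth[OF \<pi>] functional_smooth[OF \<theta>]) auto
  have "\<pi> m\<^sub>0 r = (\<Sum>j\<in>insert a J. x j * \<pi> m\<^sub>0 (e j m\<^sub>0))"
    unfolding r_def by (rule functional_sum[OF \<pi> U(2) m0 mem])
  also have "\<dots> = d m\<^sub>0"
    using insert.hyps by (auto simp: x_def d_def intro!: sum.cong)
  finally have d0: "d m\<^sub>0 \<noteq> 0" using \<pi>r by simp
  define W' where "W' = {m \<in> W\<^sub>2. d m \<noteq> 0}"
  have W': "openin (mtop M) W'" unfolding W'_def by (rule open_nonzero_set[OF mfd W2(1) d])
  have sub: "W' \<subseteq> W\<^sub>2" "W' \<subseteq> W\<^sub>1" "W' \<subseteq> U" "W' \<subseteq> W" using W2 by (auto simp: W'_def)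
  define \<eta> where "\<eta> m v = inverse (d m) * \<pi> m v + (\<Sum>j\<in>J. (- inverse (d m) * \<pi> m (e j m)) * \<theta> j m v)"
    for m v
  have inv: "smooth_fun_on M W' (\<lambda>m. inverse (d m))"
    by (rule smooth_fun_on_inverse[OF mfd W' smooth_fun_on_subset[OF mfd d sub(1)]])
       (simp add: W'_def)
  have \<eta>: "smooth_functional W' \<eta>"
    unfolding \<eta>_def using sub sec
    by (intro functional_lincomb[OF W'] functional_subset[OF \<pi>] functional_subset[OF \<theta>] inv
        smooth_fun_on_mult[OF mfd W'] smooth_fun_on_uminus[OF mfd W'] functional_smooth[OF \<pi> W']) auto
  define \<theta>' where "\<theta>' i = (if i = a then \<eta>
      else (\<lambda>m v. 1 * \<theta> i m v + (\<Sum>j\<in>{a}. - \<theta> i m (e a m) * \<eta> m v)))" for i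
  have \<theta>'1: "smooth_functional W' (\<theta>' i)" if "i \<in> insert a J" for i
  proof (cases "i = a")
    case False
    then have i: "i \<in> J" using that by simp
    have "smooth_functional W' (\<lambda>m v. 1 * \<theta> i m v + (\<Sum>j\<in>{a}. - \<theta> i m (e a m) * \<eta> m v))"
      using sub sec
      by (intro functional_lincomb[OF W'] functional_subset[OF \<theta>[OF i]] \<eta>
          smooth_fun_on_const[OF mfd] smooth_fun_on_uminus[OF mfd W']
          functional_smooth[OF \<theta>[OF i] W']) auto
    then show ?thesis using False by (simp add: \<theta>'_def)
  qed (simp add: \<theta>'_def \<eta>)
  have \<eta>a: "\<eta> m (e a m) = 1" if "m \<in> W'" for m
  proof -
    have "\<eta> m (e a m) = inverse (d m) * d m"
      unfolding \<eta>_def d_def[of m] distrib_left sum_distrib_left by (simp add: algebra_simps)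
    then show ?thesis using that by (simp add: W'_def)
  qed
  have \<eta>J: "\<eta> m (e j m) = 0" if "m \<in> W'" "j \<in> J" for m j
  proof -
    have "(\<Sum>k\<in>J. (- inverse (d m) * \<pi> m (e k m)) * \<theta> k m (e j m))
        = (\<Sum>k\<in>J. if k = j then - inverse (d m) * \<pi> m (e j m) else 0)"
      using that sub by (intro sum.cong) (auto simp: dual)
    then show ?thesis using that insert.hyps by (simp add: \<eta>_def)
  qed
  have "\<theta>' i m (e j m) = (if i = j then 1 else 0)"
    if "m \<in> W'" "i \<in> insert a J" "j \<in> insert a J" for m i j
    using that \<eta>a \<eta>J dual[of m] sub insert.hyps by (auto simp: \<theta>'_def)
  moreover have "m\<^sub>0 \<in> W'" using d0 W1 U by (simp add: W'_def W\<^sub>2_def)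
  ultimately show ?case
    using W' sub \<theta>'1 by (intro exI[of _ W'] exI[of _ \<theta>'] conjI ballI) simp_all
qed

end


section \<open>Frames of kernels of constant rank\<close>

context complex_bundle
begin

lemma sum_real_imag_pairs:
  "(\<Sum>p\<in>{..<n} \<times> {1, \<i>}. f p) = (\<Sum>j<n. f (j, 1) + f (j, \<i>))"
proof -
  have "(1::complex) \<noteq> \<i>" by (simp add: complex_eq_iff)
  then have "(\<Sum>u\<in>{1, \<i>}. f (j, u)) = f (j, 1) + f (j, \<i>)" for j by simp
  moreover have "(\<Sum>p\<in>{..<n} \<times> {1, \<i>}. f p) = (\<Sum>j<n. \<Sum>u\<in>{1, \<i>}. f (j, u))"
    using sum.cartesian_product[of "\<lambda>j u. f (j, u)" "{1, \<i>}" "{..<n}"] by simp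
  ultimately show ?thesis by simp
qed

text \<open>A complex frame \<open>b\<^sub>0, \<dots>\<close> gives the real frame \<open>b\<^sub>0, \<i> b\<^sub>0, \<dots>\<close>. Its members are indexed by pairs of
a number and one of the complex units \<open>1\<close> and \<open>\<i>\<close>.\<close>

lemma real_frame:
  assumes t: "(U, n, \<phi>) \<in> trivs A"
  defines "J \<equiv> {..<n} \<times> {1, \<i>}"
    and "e \<equiv> \<lambda>p m. scl A (snd p) (inv_into (fibre A m) (\<phi> m) (unit_tuple (fst p)))"
  shows "\<And>p. p \<in> J \<Longrightarrow> smooth_section_on M A U (e p)"
    and "\<And>m. m \<in> U \<Longrightarrow> independent_family J (\<lambda>p. e p m)"
    and "\<And>m v. m \<in> U \<Longrightarrow> v \<in> fibre A m \<Longrightarrow> \<exists>x. v = (\<Sum>p\<in>J. x p \<cdot> e p m)"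
proof -
  show "smooth_section_on M A U (e p)" if "p \<in> J" for p
    unfolding e_def using that
    by (intro section_scale triv_dom_open[OF t] smooth_fun_on_const[OF mfd] triv_frame_section[OF t])
       (auto simp: J_def)
  fix m assume m: "m \<in> U"
  have comb: "(\<Sum>p\<in>J. x p \<cdot> e p m)
      = (\<Sum>j<n. scl A (Complex (x (j, 1)) (x (j, \<i>))) (inv_into (fibre A m) (\<phi> m) (unit_tuple j)))"
    for x
    by (simp add: J_def sum_real_imag_pairs e_def Complex_eq scale_left_distrib mult.commute)
  show "independent_family J (\<lambda>p. e p m)"
    unfolding independent_family_def
  proof (intro allI impI)
    fix x assume 0: "(\<Sum>p\<in>J. x p \<cdot> e p m) = 0"
    have "Complex (x (i, 1)) (x (i, \<i>)) = 0" if i: "i < n" for i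
    proof -
      have "0 = \<phi> m (\<Sum>p\<in>J. x p \<cdot> e p m) i" using 0 coord_zero[OF t m] by simp
      also have "\<dots> = (\<Sum>j<n. Complex (x (j, 1)) (x (j, \<i>)) * unit_tuple j i)"
        unfolding comb by (subst coord_sum[OF t m]) (auto simp: frame_mem[OF t m] frame_coord[OF t m])
      also have "\<dots> = Complex (x (i, 1)) (x (i, \<i>))"
        using i by (simp add: if_distrib cong: if_cong)
      finally show ?thesis by simp
    qed
    then show "\<forall>p\<in>J. x p = 0" by (auto simp: J_def complex_eq_iff)
  qed
  fix v assume v: "v \<in> fibre A m"
  define x where "x p = (if snd p = 1 then Re (\<phi> m v (fst p)) else Im (\<phi> m v (fst p)))"
    for p :: "nat \<times> complex"
  have "v = (\<Sum>p\<in>J. x p \<cdot> e p m)"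
    unfolding comb using frame_expand[OF t m v] by (simp add: x_def complex_eq_iff)
  then show "\<exists>x. v = (\<Sum>p\<in>J. x p \<cdot> e p m)" by (rule exI[of _ x])
qed

text \<open>Elimination in families: from a frame of the whole bundle one obtains sections whose span contains
the common kernel of the functionals near \<open>m\<^sub>0\<close> and lies in it at \<open>m\<^sub>0\<close>. The functionals are
treated one after the other. If \<open>\<mu> d\<close> vanishes at \<open>m\<^sub>0\<close> on all the sections found so far, they are
kept, although \<open>\<mu> d\<close> may be nonzero on them at nearby points. Otherwise \<open>\<mu> d\<close> is nonzero on some
\<open>e b\<close>, also near \<open>m\<^sub>0\<close>; then \<open>e b\<close> is dropped and subtracted from the others with the
multiplicities that move them into the kernel of \<open>\<mu> d\<close>.

Since the rank may jump, more than the inclusion at nearby points cannot be asked for here; it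
becomes an equality when the rank is constant.\<close>

lemma partial_kernel_frame:
  fixes e :: "'i \<Rightarrow> 'm \<Rightarrow> 'v" and \<mu> :: "nat \<Rightarrow> 'm \<Rightarrow> 'v \<Rightarrow> real"
  assumes W: "openin (mtop M) W" "m\<^sub>0 \<in> W" and J: "finite J"
    and sec: "\<And>j. j \<in> J \<Longrightarrow> smooth_section_on M A W (e j)"
    and ind: "\<And>m. m \<in> W \<Longrightarrow> independent_family J (\<lambda>j. e j m)"
    and span: "\<And>m v. m \<in> W \<Longrightarrow> v \<in> fibre A m \<Longrightarrow> \<exists>x. v = (\<Sum>j\<in>J. x j \<cdot> e j m)"
    and \<mu>: "\<And>i. i < d \<Longrightarrow> smooth_functional W (\<mu> i)"
  shows "\<exists>J' W' e'. J' \<subseteq> J \<and> openin (mtop M) W' \<and> m\<^sub>0 \<in> W' \<and> W' \<subseteq> W \<and>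
    (\<forall>j\<in>J'. smooth_section_on M A W' (e' j)) \<and>
    (\<forall>m\<in>W'. independent_family J' (\<lambda>j. e' j m)) \<and>
    (\<forall>m\<in>W'. \<forall>v\<in>fibre A m. (\<forall>i<d. \<mu> i m v = 0) \<longrightarrow> (\<exists>x. v = (\<Sum>j\<in>J'. x j \<cdot> e' j m))) \<and>
    (\<forall>j\<in>J'. \<forall>i<d. \<mu> i m\<^sub>0 (e' j m\<^sub>0) = 0)"
  using \<mu>
proof (induction d)
  case 0
  show ?case
    by (rule exI[of _ J], rule exI[of _ W], rule exI[of _ e]) (use W sec ind span in auto)
next
  case (Suc d)
  have "\<exists>J' W' e'. J' \<subseteq> J \<and> openin (mtop M) W' \<and> m\<^sub>0 \<in> W' \<and> W' \<subseteq> W \<and>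
    (\<forall>j\<in>J'. smooth_section_on M A W' (e' j)) \<and>
    (\<forall>m\<in>W'. independent_family J' (\<lambda>j. e' j m)) \<and>
    (\<forall>m\<in>W'. \<forall>v\<in>fibre A m. (\<forall>i<d. \<mu> i m v = 0) \<longrightarrow> (\<exists>x. v = (\<Sum>j\<in>J'. x j \<cdot> e' j m))) \<and>
    (\<forall>j\<in>J'. \<forall>i<d. \<mu> i m\<^sub>0 (e' j m\<^sub>0) = 0)"
    by (rule Suc.IH) (rule Suc.prems, simp)
  then obtain J\<^sub>1 W\<^sub>1 e\<^sub>1 where 1: "J\<^sub>1 \<subseteq> J" "openin (mtop M) W\<^sub>1" "m\<^sub>0 \<in> W\<^sub>1" "W\<^sub>1 \<subseteq> W"
    and *: "\<forall>j\<in>J\<^sub>1. smooth_section_on M A W\<^sub>1 (e\<^sub>1 j)"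
      "\<forall>m\<in>W\<^sub>1. independent_family J\<^sub>1 (\<lambda>j. e\<^sub>1 j m)"
      "\<forall>m\<in>W\<^sub>1. \<forall>v\<in>fibre A m. (\<forall>i<d. \<mu> i m v = 0) \<longrightarrow> (\<exists>x. v = (\<Sum>j\<in>J\<^sub>1. x j \<cdot> e\<^sub>1 j m))"
      "\<forall>j\<in>J\<^sub>1. \<forall>i<d. \<mu> i m\<^sub>0 (e\<^sub>1 j m\<^sub>0) = 0"
    by (elim exE conjE)
  note sec1 = *(1)[rule_format] and ind1 = *(2)[rule_format] and ker1 = *(4)[rule_format]
  have span1: "\<exists>x. v = (\<Sum>j\<in>J\<^sub>1. x j \<cdot> e\<^sub>1 j m)"
    if "m \<in> W\<^sub>1" "v \<in> fibre A m" "\<And>i. i < d \<Longrightarrow> \<mu> i m v = 0" for m v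
    using *(3) that by blast
  show ?case
  proof (cases "\<forall>j\<in>J\<^sub>1. \<mu> d m\<^sub>0 (e\<^sub>1 j m\<^sub>0) = 0")
    case True
    show ?thesis
      by (rule exI[of _ J\<^sub>1], rule exI[of _ W\<^sub>1], rule exI[of _ e\<^sub>1])
         (use 1 sec1 ind1 span1 ker1 True in \<open>auto simp: less_Suc_eq\<close>)
  next
    case False
    then obtain b where b: "b \<in> J\<^sub>1" "\<mu> d m\<^sub>0 (e\<^sub>1 b m\<^sub>0) \<noteq> 0" by blast
    have fin: "finite J\<^sub>1" using 1(1) J finite_subset by blast
    define a where "a j m = \<mu> d m (e\<^sub>1 j m)" for j m
    have a: "smooth_fun_on M W\<^sub>1 (a j)" if "j \<in> J\<^sub>1" for j
      unfolding a_def by (rule functional_smooth[OF Suc.prems 1(2,4) sec1[OF that]]) simp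
    define W' where "W' = {m \<in> W\<^sub>1. a b m \<noteq> 0}"
    have W': "openin (mtop M) W'" "W' \<subseteq> W\<^sub>1" "m\<^sub>0 \<in> W'"
      unfolding W'_def using open_nonzero_set[OF mfd 1(2) a[OF b(1)]] b 1(3) by (auto simp: a_def)
    \<comment> \<open>chosen such that \<open>\<mu> d\<close> vanishes on \<open>e\<^sub>1 j + q j \<cdot> e\<^sub>1 b\<close>\<close>
    define q where "q j m = - a j m * inverse (a b m)" for j m
    define e' where "e' j m = e\<^sub>1 j m + q j m \<cdot> e\<^sub>1 b m" for j m
    define J' where "J' = J\<^sub>1 - {b}"
    have sum_J1: "(\<Sum>j\<in>J\<^sub>1. f j) = f b + (\<Sum>j\<in>J'. f j)" for f :: "'i \<Rightarrow> 'v"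
      unfolding J'_def by (rule sum.remove[OF fin b(1)])
    have sum_J1_real: "(\<Sum>j\<in>J\<^sub>1. f j) = f b + (\<Sum>j\<in>J'. f j)" for f :: "'i \<Rightarrow> real"
      unfolding J'_def by (rule sum.remove[OF fin b(1)])
    have comb: "(\<Sum>j\<in>J'. x j \<cdot> e' j m) =
        (\<Sum>j\<in>J\<^sub>1. (if j = b then (\<Sum>j\<in>J'. x j * q j m) else x j) \<cdot> e\<^sub>1 j m)" for x m
    proof -
      have "(\<Sum>j\<in>J'. x j \<cdot> e' j m) = (\<Sum>j\<in>J'. x j \<cdot> e\<^sub>1 j m) + (\<Sum>j\<in>J'. x j * q j m) \<cdot> e\<^sub>1 b m"
        by (simp add: e'_def R.scale_right_distrib sum.distrib R.scale_sum_left del: of_real_sum)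
      moreover have "(\<Sum>j\<in>J'. (if j = b then (\<Sum>j\<in>J'. x j * q j m) else x j) \<cdot> e\<^sub>1 j m)
          = (\<Sum>j\<in>J'. x j \<cdot> e\<^sub>1 j m)"
        by (rule sum.cong) (auto simp: J'_def)
      ultimately show ?thesis by (simp add: sum_J1 del: of_real_sum)
    qed
    have sec': "smooth_section_on M A W' (e' j)" if "j \<in> J'" for j
    proof -
      have "smooth_fun_on M W' (q j)"
        unfolding q_def
        by (intro smooth_fun_on_mult[OF mfd W'(1)] smooth_fun_on_uminus[OF mfd W'(1)]
            smooth_fun_on_inverse[OF mfd W'(1)] smooth_fun_on_subset[OF mfd a W'(2)])
           (use that b in \<open>auto simp: W'_def J'_def\<close>)
      then show ?thesis
        unfolding e'_def using that b
        by (intro section_add[OF W'(1)] section_real_scale[OF W'(1)] section_subset[OF sec1 W'(2)])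
           (auto simp: J'_def)
    qed
    have ind': "independent_family J' (\<lambda>j. e' j m)" if m: "m \<in> W'" for m
      unfolding independent_family_def
    proof (intro allI impI ballI)
      fix x j assume x: "(\<Sum>j\<in>J'. x j \<cdot> e' j m) = 0" and j: "j \<in> J'"
      define y where "y k = (if k = b then (\<Sum>j\<in>J'. x j * q j m) else x k)" for k
      have "y j = 0"
        by (rule independent_familyD[OF ind1, of m])
           (use x j m W' comb in \<open>auto simp: y_def J'_def\<close>)
      moreover have "j \<noteq> b" using j by (simp add: J'_def)
      ultimately show "x j = 0" by (simp add: y_def)
    qed
    have span': "\<exists>x. v = (\<Sum>j\<in>J'. x j \<cdot> e' j m)"
      if m: "m \<in> W'" and v: "v \<in> fibre A m" and 0: "\<And>i. i < Suc d \<Longrightarrow> \<mu> i m v = 0" for m v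
    proof -
      have m1: "m \<in> W\<^sub>1" "m \<in> W" using m W'(2) 1(4) by auto
      obtain x where x: "v = (\<Sum>j\<in>J\<^sub>1. x j \<cdot> e\<^sub>1 j m)" using span1[OF m1(1) v] 0 by auto
      have "0 = \<mu> d m v" using 0[of d] by simp
      also have "\<dots> = (\<Sum>j\<in>J\<^sub>1. x j * a j m)"
        unfolding x a_def
        by (rule functional_sum[OF Suc.prems m1(2) openin_points[OF W(1) m1(2)]
              smooth_section_mem[OF sec1 m1(1)]]) simp_all
      also have "\<dots> = x b * a b m + (\<Sum>j\<in>J'. x j * a j m)" by (rule sum_J1_real)
      finally have "x b * a b m = (\<Sum>j\<in>J'. x j * - a j m)" by (simp add: sum_negf)
      moreover have "a b m \<noteq> 0" using m by (simp add: W'_def)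
      ultimately have "x b = (\<Sum>j\<in>J'. x j * - a j m) * inverse (a b m)" by (simp add: field_simps)
      then have "x b = (\<Sum>j\<in>J'. x j * q j m)"
        unfolding q_def sum_distrib_right by (simp add: mult.assoc)
      then have "v = (\<Sum>j\<in>J'. x j \<cdot> e' j m)"
        unfolding comb x by (intro sum.cong) auto
      then show ?thesis by (rule exI[of _ x])
    qed
    have ker': "\<mu> i m\<^sub>0 (e' j m\<^sub>0) = 0" if j: "j \<in> J'" and i: "i < Suc d" for i j
    proof -
      have m0: "m\<^sub>0 \<in> points M" using openin_points[OF W] .
      have mem: "e\<^sub>1 j m\<^sub>0 \<in> fibre A m\<^sub>0" "e\<^sub>1 b m\<^sub>0 \<in> fibre A m\<^sub>0"
        using smooth_section_mem[OF sec1 1(3)] j b by (auto simp: J'_def)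
      have "\<mu> i m\<^sub>0 (e' j m\<^sub>0) = \<mu> i m\<^sub>0 (e\<^sub>1 j m\<^sub>0) + q j m\<^sub>0 * \<mu> i m\<^sub>0 (e\<^sub>1 b m\<^sub>0)"
        unfolding e'_def
        using functional_add[OF Suc.prems[OF i] W(2) mem(1) R.subspace_scale[OF fibre_R_subspace[OF m0] mem(2)]]
          functional_scale[OF Suc.prems[OF i] W(2) mem(2)] by simp
      also have "\<dots> = 0"
        using i j b ker1 by (auto simp: less_Suc_eq q_def a_def J'_def)
      finally show ?thesis .
    qed
    show ?thesis
      by (rule exI[of _ J'], rule exI[of _ W'], rule exI[of _ e'])
         (use 1 W' sec' ind' span' ker' in \<open>auto simp: J'_def\<close>)
  qed
qed

lemma independent_family_span:
  assumes J: "finite J" and f: "independent_family J f"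
  shows "range (\<lambda>x. \<Sum>j\<in>J. x j \<cdot> f j) = R.span (f ` J)" and "R.dim (R.span (f ` J)) = card J"
    and "R.independent (f ` J)" and "card (f ` J) = card J"
proof -
  have inj: "inj_on f J"
  proof (rule inj_onI, rule ccontr)
    fix i j assume ij: "i \<in> J" "j \<in> J" "f i = f j" "i \<noteq> j"
    define x where "x k = (if k = i then 1 else 0) - (if k = j then 1 else 0 :: real)" for k
    have "(\<Sum>k\<in>J. x k \<cdot> f k) = (\<Sum>k\<in>J. (if k = i then f k else 0) - (if k = j then f k else 0))"
      using ij by (intro sum.cong) (auto simp: x_def)
    also have "\<dots> = 0" using J ij by (simp add: sum_subtractf)
    finally have "x i = 0" by (rule independent_familyD[OF f _ ij(1)])
    then show False using ij by (simp add: x_def)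
  qed
  have reindex: "(\<Sum>v\<in>f ` J. u v \<cdot> v) = (\<Sum>j\<in>J. u (f j) \<cdot> f j)" for u
    by (simp add: sum.reindex[OF inj])
  show ind: "R.independent (f ` J)"
  proof (rule R.independent_if_scalars_zero)
    fix u v assume "(\<Sum>v\<in>f ` J. u v \<cdot> v) = 0" "v \<in> f ` J"
    then show "u v = 0" using independent_familyD[OF f, of "\<lambda>j. u (f j)"] reindex by auto
  qed (use J in simp)
  show c: "card (f ` J) = card J" by (rule card_image[OF inj])
  show "R.dim (R.span (f ` J)) = card J" using R.dim_span_eq_card_independent[OF ind] c by simp
  show "range (\<lambda>x. \<Sum>j\<in>J. x j \<cdot> f j) = R.span (f ` J)"
  proof
    show "range (\<lambda>x. \<Sum>j\<in>J. x j \<cdot> f j) \<subseteq> R.span (f ` J)"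
      by (intro image_subsetI R.span_sum R.span_scale R.span_base imageI)
    show "R.span (f ` J) \<subseteq> range (\<lambda>x. \<Sum>j\<in>J. x j \<cdot> f j)"
      using J by (auto simp: R.span_finite reindex)
  qed
qed

text \<open>The ambient space may have infinite dimension, hence the comparison with a finite spanning
set.\<close>

lemma subspace_of_full_dim:
  assumes "R.subspace K" "K \<subseteq> R.span T" "finite T" "R.dim K = card T"
  shows "K = R.span T"
proof -
  obtain B where B: "B \<subseteq> K" "R.independent B" "K \<subseteq> R.span B" "card B = R.dim K"
    using R.basis_exists .
  have finB: "finite B" using R.independent_span_bound[OF assms(3) B(2)] B(1) assms(2) by blast
  have "R.span T \<subseteq> R.span B"
  proof (rule subsetI, rule ccontr)
    fix v assume v: "v \<in> R.span T" "v \<notin> R.span B"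
    have "R.independent (insert v B)" using v B(2) R.independent_insertI by blast
    then have "card (insert v B) \<le> card T"
      using R.independent_span_bound[OF assms(3)] v(1) B(1) assms(2) by blast
    moreover have "v \<notin> B" using v(2) R.span_base by blast
    ultimately show False using finB B(4) assms(4) by simp
  qed
  moreover have "R.span B \<subseteq> K" using R.span_minimal[OF B(1) assms(1)] .
  ultimately show ?thesis using assms(2) by blast
qed

text \<open>The sections of the preceding elimination span the kernel at \<open>m\<^sub>0\<close>, so their number is the rank.
At nearby points their span contains the kernel and has the same dimension, hence equals it. It
remains to number the sections.\<close>

lemma constant_rank_kernel_frame:
  fixes \<mu> :: "nat \<Rightarrow> 'm \<Rightarrow> 'v \<Rightarrow> real"
  assumes W: "openin (mtop M) W" "m\<^sub>0 \<in> W"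
    and \<mu>: "\<And>i. i < d \<Longrightarrow> smooth_functional W (\<mu> i)"
    and K: "\<And>m. m \<in> W \<Longrightarrow> K m = {v \<in> fibre A m. \<forall>i<d. \<mu> i m v = 0}"
    and rank: "\<And>m. m \<in> W \<Longrightarrow> R.dim (K m) = k"
  obtains W' e where "openin (mtop M) W'" "m\<^sub>0 \<in> W'" "W' \<subseteq> W"
    and "\<And>j. j < k \<Longrightarrow> smooth_section_on M A W' (e j)"
    and "\<And>m. m \<in> W' \<Longrightarrow> independent_family {..<k} (\<lambda>j. e j m)"
    and "\<And>m. m \<in> W' \<Longrightarrow> K m = range (\<lambda>x. \<Sum>j<k. x j \<cdot> e j m)"
proof -
  have m0: "m\<^sub>0 \<in> points M" by (rule openin_points[OF W])
  obtain U n \<phi> where t: "(U, n, \<phi>) \<in> trivs A" "m\<^sub>0 \<in> U" using triv_exists[OF m0] .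
  have UW: "openin (mtop M) (U \<inter> W)" "m\<^sub>0 \<in> U \<inter> W" using W t triv_dom_open by auto
  note frame = real_frame[OF t(1)]
  have "\<exists>J W' e. J \<subseteq> {..<n} \<times> {1, \<i>} \<and> openin (mtop M) W' \<and> m\<^sub>0 \<in> W' \<and> W' \<subseteq> U \<inter> W \<and>
    (\<forall>j\<in>J. smooth_section_on M A W' (e j)) \<and>
    (\<forall>m\<in>W'. independent_family J (\<lambda>j. e j m)) \<and>
    (\<forall>m\<in>W'. \<forall>v\<in>fibre A m. (\<forall>i<d. \<mu> i m v = 0) \<longrightarrow> (\<exists>x. v = (\<Sum>j\<in>J. x j \<cdot> e j m))) \<and>
    (\<forall>j\<in>J. \<forall>i<d. \<mu> i m\<^sub>0 (e j m\<^sub>0) = 0)"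
    by (rule partial_kernel_frame[OF UW _ section_subset[OF frame(1)] frame(2,3) functional_subset[OF \<mu>]]) auto
  then obtain J W' e where J: "J \<subseteq> {..<n} \<times> {1, \<i>}" and W': "openin (mtop M) W'" "m\<^sub>0 \<in> W'" "W' \<subseteq> U \<inter> W"
    and *: "\<forall>j\<in>J. smooth_section_on M A W' (e j)"
      "\<forall>m\<in>W'. independent_family J (\<lambda>j. e j m)"
      "\<forall>m\<in>W'. \<forall>v\<in>fibre A m. (\<forall>i<d. \<mu> i m v = 0) \<longrightarrow> (\<exists>x. v = (\<Sum>j\<in>J. x j \<cdot> e j m))"
      "\<forall>j\<in>J. \<forall>i<d. \<mu> i m\<^sub>0 (e j m\<^sub>0) = 0"
    by (elim exE conjE)
  note sec = *(1)[rule_format] and ind = *(2)[rule_format] and ker = *(4)[rule_format]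
  have span: "\<exists>x. v = (\<Sum>j\<in>J. x j \<cdot> e j m)"
    if "m \<in> W'" "v \<in> fibre A m" "\<forall>i<d. \<mu> i m v = 0" for m v
    using *(3) that by blast
  have fin: "finite J" by (rule finite_subset[OF J]) simp
  note ifs = independent_family_span[OF fin ind]
  have K_sub: "K m \<subseteq> R.span ((\<lambda>j. e j m) ` J)" if "m \<in> W'" for m
    using span[OF that] that W'(3) K[of m] by (auto simp: ifs(1)[OF that, symmetric] image_iff)
  have "R.span ((\<lambda>j. e j m\<^sub>0) ` J) \<subseteq> K m\<^sub>0"
  proof (subst ifs(1)[OF W'(2), symmetric], rule image_subsetI)
    fix x
    have mem: "e j m\<^sub>0 \<in> fibre A m\<^sub>0" if "j \<in> J" for j using smooth_section_mem[OF sec[OF that] W'(2)] .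
    have "\<mu> i m\<^sub>0 (\<Sum>j\<in>J. x j \<cdot> e j m\<^sub>0) = 0" if "i < d" for i
      by (subst functional_sum[OF \<mu>[OF that] W(2) m0]) (use mem ker that in auto)
    moreover have "(\<Sum>j\<in>J. x j \<cdot> e j m\<^sub>0) \<in> fibre A m\<^sub>0"
      using mem by (auto intro!: R.subspace_sum R.subspace_scale fibre_R_subspace m0)
    ultimately show "(\<Sum>j\<in>J. x j \<cdot> e j m\<^sub>0) \<in> K m\<^sub>0" using K[OF W(2)] by simp
  qed
  then have "K m\<^sub>0 = R.span ((\<lambda>j. e j m\<^sub>0) ` J)" using K_sub[OF W'(2)] by blast
  then have k: "k = card J" using ifs(2)[OF W'(2)] rank[OF W(2)] by simp
  have K_eq: "K m = range (\<lambda>x. \<Sum>j\<in>J. x j \<cdot> e j m)" if m: "m \<in> W'" for m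
    unfolding ifs(1)[OF m]
  proof (rule subspace_of_full_dim[OF _ K_sub[OF m]])
    have mW: "m \<in> W" "m \<in> points M" using m W'(3) openin_points[OF W(1)] by auto
    note sub = fibre_R_subspace[OF mW(2)]
    have z: "\<mu> i m 0 = 0" if "i < d" for i
      using functional_scale[OF \<mu>[OF that] mW(1) R.subspace_0[OF sub], of 0] by simp
    show "R.subspace (K m)"
      unfolding K[OF mW(1)]
      using R.subspace_0[OF sub] R.subspace_add[OF sub] R.subspace_scale[OF sub] z
      by (intro R.subspaceI)
         (auto simp: functional_add[OF \<mu> mW(1)] functional_scale[OF \<mu> mW(1)])
  qed (use fin ifs(4)[OF m] rank k m W'(3) in auto)
  obtain h where h: "bij_betw h {..<k} J"
    using ex_bij_betw_nat_finite[OF fin] k by (auto simp: atLeast0LessThan)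
  have re: "(\<Sum>j<k. x (h j) \<cdot> e (h j) m) = (\<Sum>j\<in>J. x j \<cdot> e j m)" for x m
    using sum.reindex_bij_betw[OF h, of "\<lambda>j. x j \<cdot> e j m"] .
  have hinv: "inv_into {..<k} h (h j) = j" if "j < k" for j
    using h that by (simp add: bij_betw_def)
  have re': "(\<Sum>j<k. x j \<cdot> e (h j) m) = (\<Sum>j\<in>J. x (inv_into {..<k} h j) \<cdot> e j m)" for x m
    using re[of "x \<circ> inv_into {..<k} h" m] by (simp add: hinv)
  show thesis
  proof (rule that[OF W'(1,2), of "\<lambda>j. e (h j)"])
    show "W' \<subseteq> W" using W'(3) by blast
    show "smooth_section_on M A W' (e (h j))" if "j < k" for j
      by (rule sec) (use h that in \<open>auto simp: bij_betw_def\<close>)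
    fix m assume m: "m \<in> W'"
    show "independent_family {..<k} (\<lambda>j. e (h j) m)"
      unfolding independent_family_def
    proof (intro allI impI ballI)
      fix x j assume "(\<Sum>j<k. x j \<cdot> e (h j) m) = 0" and j: "j \<in> {..<k}"
      then have "x (inv_into {..<k} h (h j)) = 0"
        using independent_familyD[OF ind[OF m], of "\<lambda>j. x (inv_into {..<k} h j)" "h j"] h
        by (auto simp: re' bij_betw_def)
      then show "x j = 0" using hinv j by simp
    qed
    show "K m = range (\<lambda>x. \<Sum>j<k. x j \<cdot> e (h j) m)"
    proof
      show "K m \<subseteq> range (\<lambda>x. \<Sum>j<k. x j \<cdot> e (h j) m)" 
        unfolding K_eq[OF m] re[symmetric] by (rule image_subsetI, rule range_eqI[OF refl])
      show "range (\<lambda>x. \<Sum>j<k. x j \<cdot> e (h j) m) \<subseteq> K m" 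
        unfolding K_eq[OF m] re' by (rule image_subsetI, rule range_eqI[OF refl])
    qed
  qed
qed

end


section \<open>Real subbundles of a complex vector bundle\<close>

locale real_subspace_family = complex_bundle M A
  for M :: "('m, 'e::real_normed_vector) manifold"
    and A :: "(complex, 'm, 'v::ab_group_add) vbundle" +
  fixes F :: "'m \<Rightarrow> 'v set"
  assumes F_subspace: "m \<in> points M \<Longrightarrow> R.subspace (F m)"
    and F_fibre: "m \<in> points M \<Longrightarrow> F m \<subseteq> fibre A m"
begin

abbreviation B :: "(real, 'm, 'v) vbundle" where
  "B \<equiv> real_subbundle M A F"

lemma B_simps [simp]: "fibre B = F" "scl B = (\<lambda>r. scl A (complex_of_real r))"
  by (simp_all add: real_subbundle_def)

lemma triv_B_iff:
  "(U, n, \<phi>) \<in> trivs B \<longleftrightarrow> local_triv M F (\<lambda>r. scl A (complex_of_real r)) (U, n, \<phi>) \<and>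
    (\<forall>j<n. smooth_section_on M A U (\<lambda>m. inv_into (F m) (\<phi> m) (unit_tuple j)))"
  by (simp add: real_subbundle_def)

text \<open>The trivialization sends a vector to its coefficients in the frame; the frame that belongs to it
is therefore the given one, and this is smooth.\<close>

lemma triv_B_of_frame:
  assumes W: "openin (mtop M) W"
    and sec: "\<And>j. j < k \<Longrightarrow> smooth_section_on M A W (e j)"
    and ind: "\<And>m. m \<in> W \<Longrightarrow> independent_family {..<k} (\<lambda>j. e j m)"
    and F: "\<And>m. m \<in> W \<Longrightarrow> F m = range (\<lambda>x. \<Sum>j<k. x j \<cdot> e j m)"
  shows "\<exists>\<phi>. (W, k, \<phi>) \<in> trivs B"
proof -
  define X :: "(nat \<Rightarrow> real) set" where "X = {x. \<forall>i\<ge>k. x i = 0}"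
  define comb where "comb m x = (\<Sum>j<k. x j \<cdot> e j m)" for m and x :: "nat \<Rightarrow> real"
  define \<phi> where "\<phi> m = inv_into X (comb m)" for m
  have bij: "bij_betw (comb m) X (F m)" if m: "m \<in> W" for m
    unfolding bij_betw_def
  proof
    show "inj_on (comb m) X"
    proof (rule inj_onI, rule ext)
      fix x y i assume xy: "x \<in> X" "y \<in> X" "comb m x = comb m y"
      have 0: "(\<Sum>j<k. (x j - y j) \<cdot> e j m) = 0"
        using xy(3) by (simp add: comb_def R.scale_left_diff_distrib sum_subtractf del: of_real_diff)
      show "x i = y i"
        using independent_familyD[OF ind[OF m] 0, of i] xy(1,2)
        by (cases "i < k") (auto simp: X_def)
    qed
    have "comb m x \<in> comb m ` X" for x
    proof
      show "(\<lambda>i. if i < k then x i else 0) \<in> X" by (simp add: X_def)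
      show "comb m x = comb m (\<lambda>i. if i < k then x i else 0)" by (simp add: comb_def)
    qed
    then show "comb m ` X = F m" unfolding F[OF m] comb_def[symmetric] by blast
  qed
  have \<phi>_bij: "bij_betw (\<phi> m) (F m) X" if "m \<in> W" for m
    unfolding \<phi>_def by (rule bij_betw_inv_into[OF bij[OF that]])
  have \<phi>_comb: "\<phi> m (comb m x) = x" if "m \<in> W" "x \<in> X" for m x
    unfolding \<phi>_def using bij[OF that(1)] that(2) by (simp add: bij_betw_def)
  have rep: "\<exists>x\<in>X. v = comb m x" if "m \<in> W" "v \<in> F m" for m v
    using bij[OF that(1)] that(2) by (auto simp: bij_betw_def)
  have "local_triv M F (\<lambda>r. scl A (complex_of_real r)) (W, k, \<phi>)"
    unfolding local_triv_def prod.case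
  proof (intro conjI ballI allI)
    fix m v assume m: "m \<in> W" and "v \<in> F m"
    then obtain x where x: "x \<in> X" "v = comb m x" using rep by blast
    show "\<phi> m (v + w) i = \<phi> m v i + \<phi> m w i" if w: "w \<in> F m" for w i
    proof -
      obtain y where y: "y \<in> X" "w = comb m y" using rep[OF m w] by blast
      have "v + w = comb m (\<lambda>i. x i + y i)"
        by (simp add: x y comb_def R.scale_left_distrib sum.distrib del: of_real_add)
      moreover have "(\<lambda>i. x i + y i) \<in> X" using x y by (simp add: X_def)
      ultimately show ?thesis using x y \<phi>_comb[OF m] by simp
    qed
  next
    fix m a v i assume m: "m \<in> W" and "v \<in> F m"
    then obtain x where x: "x \<in> X" "v = comb m x" using rep by blast
    have "a \<cdot> v = comb m (\<lambda>i. a * x i)"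
      by (simp add: x comb_def R.scale_sum_right)
    moreover have "(\<lambda>i. a * x i) \<in> X" using x by (simp add: X_def)
    ultimately show "\<phi> m (a \<cdot> v) i = a * \<phi> m v i" using x \<phi>_comb[OF m] by simp
  qed (use W \<phi>_bij in \<open>auto simp: X_def\<close>)
  moreover have "smooth_section_on M A W (\<lambda>m. inv_into (F m) (\<phi> m) (unit_tuple j))" if j: "j < k" for j
  proof (rule section_cong[OF sec[OF j] W])
    fix m assume m: "m \<in> W"
    have u: "unit_tuple j \<in> X" using j by (simp add: X_def)
    have "comb m (unit_tuple j) = (\<Sum>i<k. if i = j then e i m else 0)"
      unfolding comb_def by (rule sum.cong) auto
    then have e: "comb m (unit_tuple j) = e j m" using j by simp
    have "comb m (unit_tuple j) \<in> F m" using bij[OF m] u by (auto simp: bij_betw_def)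
    then show "e j m = inv_into (F m) (\<phi> m) (unit_tuple j)"
      using inv_into_f_f[OF bij_betw_imp_inj_on[OF \<phi>_bij[OF m]], of "comb m (unit_tuple j)"] \<phi>_comb[OF m u] e
      by simp
  qed
  ultimately show ?thesis unfolding triv_B_iff by blast
qed

context
  fixes U n \<phi>
  assumes t: "(U, n, \<phi>) \<in> trivs B"
begin

text \<open>The local frame belonging to a trivialization, whose smoothness in \<open>A\<close> is the defining condition for the
trivializations of a real subbundle.\<close>

definition frame :: "nat \<Rightarrow> 'm \<Rightarrow> 'v" where
  "frame j m = inv_into (F m) (\<phi> m) (unit_tuple j)"

lemma triv_B_local: "local_triv M F (\<lambda>r. scl A (complex_of_real r)) (U, n, \<phi>)"
  and triv_B_section: "j < n \<Longrightarrow> smooth_section_on M A U (frame j)"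
  using t unfolding triv_B_iff frame_def by blast+

lemma triv_B_open: "openin (mtop M) U" by (rule local_triv_open[OF triv_B_local])

context
  fixes m
  assumes m: "m \<in> U"
begin

lemmas triv_B_prems =
  triv_B_local m R.vector_space_axioms F_subspace[OF openin_points[OF triv_B_open m]]

lemmas B_coord_zero = triv_zero[OF triv_B_prems]
lemmas B_coord_sum = triv_sum[OF triv_B_prems]
lemmas B_frame_mem = triv_frame_mem[OF triv_B_prems, folded frame_def]
lemmas B_frame_coord = triv_frame_coord[OF triv_B_prems, folded frame_def]
lemmas B_expand = triv_expand[OF triv_B_prems, folded frame_def]

lemma frame_independent: "independent_family {..<n} (\<lambda>j. frame j m)"
  unfolding independent_family_def
proof (intro allI impI ballI)
  fix x i assume x: "(\<Sum>j<n. x j \<cdot> frame j m) = 0" and i: "i \<in> {..<n}"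
  have "0 = \<phi> m (\<Sum>j<n. x j \<cdot> frame j m) i" using x B_coord_zero by simp
  also have "\<dots> = (\<Sum>j<n. x j * unit_tuple j i)"
    by (subst B_coord_sum) (auto simp: B_frame_mem B_frame_coord)
  also have "\<dots> = x i" using i by (simp add: if_distrib cong: if_cong)
  finally show "x i = 0" by simp
qed

end

text \<open>The coefficients of \<open>s\<close> in the frame are the values on \<open>s\<close> of the dual functionals of the frame.\<close>

lemma B_coord_smooth:
  assumes W: "openin (mtop M) W" and s: "smooth_section_on M A W s" "\<And>m. m \<in> W \<Longrightarrow> s m \<in> F m"
    and i: "i < n"
  shows "smooth_fun_on M (U \<inter> W) (\<lambda>m. \<phi> m (s m) i)"
proof (rule smooth_fun_on_local[OF mfd])
  fix m\<^sub>0 assume m0: "m\<^sub>0 \<in> U \<inter> W"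
  have UW: "openin (mtop M) (U \<inter> W)" using W triv_B_open by blast
  have "\<exists>W' \<theta>. openin (mtop M) W' \<and> m\<^sub>0 \<in> W' \<and> W' \<subseteq> U \<inter> W \<and>
      (\<forall>i\<in>{..<n}. smooth_functional W' (\<theta> i)) \<and>
      (\<forall>m\<in>W'. \<forall>i\<in>{..<n}. \<forall>j\<in>{..<n}. \<theta> i m (frame j m) = (if i = j then 1 else 0))"
    by (rule dual_functionals[OF _ UW m0 section_subset[OF triv_B_section] frame_independent])
       (use m0 in auto)
  then obtain W' \<theta> where W': "openin (mtop M) W'" "m\<^sub>0 \<in> W'" "W' \<subseteq> U \<inter> W"
    and *: "\<forall>i\<in>{..<n}. smooth_functional W' (\<theta> i)"
    and **: "\<forall>m\<in>W'. \<forall>i\<in>{..<n}. \<forall>j\<in>{..<n}. \<theta> i m (frame j m) = (if i = j then 1 else 0)"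
    by (elim exE conjE)
  have \<theta>: "smooth_functional W' (\<theta> i)" using * i by simp
  have dual: "\<theta> i m (frame j m) = (if i = j then 1 else 0)" if "m \<in> W'" "j < n" for m j
    using ** i that by simp
  have eq: "\<theta> i m (s m) = \<phi> m (s m) i" if m: "m \<in> W'" for m
  proof -
    have mU: "m \<in> U" "m \<in> W" "m \<in> points M" using m W'(3) openin_points[OF W] by auto
    have "\<theta> i m (s m) = \<theta> i m (\<Sum>j<n. \<phi> m (s m) j \<cdot> frame j m)"
      using B_expand[OF mU(1) s(2)[OF mU(2)]] by simp
    also have "\<dots> = (\<Sum>j<n. \<phi> m (s m) j * \<theta> i m (frame j m))"
      using B_frame_mem[OF mU(1)] F_fibre[OF mU(3)] by (intro functional_sum[OF \<theta> m mU(3)]) auto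
    also have "\<dots> = (\<Sum>j<n. \<phi> m (s m) j * (if i = j then 1 else 0))"
      by (rule sum.cong) (simp_all add: dual[OF m])
    also have "\<dots> = \<phi> m (s m) i" using i by (simp add: if_distrib cong: if_cong)
    finally show ?thesis .
  qed
  have "smooth_fun_on M W' (\<lambda>m. \<theta> i m (s m))"
    using W'(3) by (intro functional_smooth[OF \<theta> W'(1)] section_subset[OF s(1)]) auto
  from smooth_fun_on_cong[OF mfd this W'(1) eq]
  have "smooth_fun_on M W' (\<lambda>m. \<phi> m (s m) i)" .
  then show "\<exists>W'. openin (mtop M) W' \<and> m\<^sub>0 \<in> W' \<and> smooth_fun_on M W' (\<lambda>m. \<phi> m (s m) i)"
    using W' by (intro exI[of _ W'] conjI)
qed

end

lemma section_B_if_section_A: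
  assumes "openin (mtop M) W" "smooth_section_on M A W s" "\<And>m. m \<in> W \<Longrightarrow> s m \<in> F m"
  shows "smooth_section_on M B W s"
  by (rule smooth_section_onI) (use assms B_coord_smooth in auto)

text \<open>Locally such a section is a combination of the smooth frame with smooth coefficients. Together
with the converse above this says that a section with values in \<open>F\<close> is smooth in the subbundle if
and only if it is smooth in \<open>A\<close>.\<close>

lemma section_A_if_section_B:
  assumes cover: "\<And>m. m \<in> points M \<Longrightarrow> \<exists>t\<in>trivs B. m \<in> fst t"
    and W: "openin (mtop M) W" and s: "smooth_section_on M B W s"
  shows "smooth_section_on M A W s"
proof (rule section_local)
  fix m assume m: "m \<in> W"
  then obtain U n \<phi> where t: "(U, n, \<phi>) \<in> trivs B" "m \<in> U"
    using cover[OF openin_points[OF W m]] by force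
  have UW: "openin (mtop M) (U \<inter> W)" using W triv_B_open[OF t(1)] by blast
  have "smooth_section_on M A (U \<inter> W) (\<lambda>m. \<Sum>j<n. \<phi> m (s m) j \<cdot> frame \<phi> j m)"
    using smooth_section_coord[OF s t(1)]
    by (intro section_sum[OF UW] section_real_scale[OF UW]
        section_subset[OF triv_B_section[OF t(1)]]) auto
  then have "smooth_section_on M A (U \<inter> W) s"
    by (rule section_cong[OF _ UW]) (use B_expand[OF t(1)] smooth_section_mem[OF s] in auto)
  then show "\<exists>W'. openin (mtop M) W' \<and> m \<in> W' \<and> smooth_section_on M A W' s"
    using UW m t by blast
qed

text \<open>The transition matrix between two trivializations consists of the coefficients of the sections of
one frame in the other frame, and these are smooth.\<close>

lemma vector_bundle_B:
  assumes cover: "\<And>m. m \<in> points M \<Longrightarrow> \<exists>t\<in>trivs B. m \<in> fst t"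
  shows "vector_bundle M B"
  unfolding vector_bundle_def B_simps
proof (intro conjI ballI)
  show "vector_space (\<lambda>r. scl A (complex_of_real r))" by (rule R.vector_space_axioms)
  show "R.subspace (F m)" if "m \<in> points M" for m using F_subspace[OF that] .
  show "\<exists>t\<in>trivs B. m \<in> fst t" if "m \<in> points M" for m using cover[OF that] .
  show "local_triv M F (\<lambda>r. scl A (complex_of_real r)) t" if "t \<in> trivs B" for t
    using that triv_B_iff by (cases t) blast
  fix t t' assume "t \<in> trivs B" "t' \<in> trivs B"
  moreover obtain U n \<phi> V k \<psi> where "t = (U, n, \<phi>)" "t' = (V, k, \<psi>)" by (cases t; cases t')
  ultimately have t: "(U, n, \<phi>) \<in> trivs B" "(V, k, \<psi>) \<in> trivs B" "t = (U, n, \<phi>)" "t' = (V, k, \<psi>)"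
    by auto
  \<comment> \<open>zero outside the matrix, since all entries \<open>g i j\<close> are required to be smooth\<close>
  define g where "g i j m = (if i < k \<and> j < n then \<psi> m (frame \<phi> j m) i else 0)" for i j m
  have "smooth_fun_on M (U \<inter> V) (g i j)" for i j
  proof (cases "i < k \<and> j < n")
    case True
    then have "smooth_fun_on M (V \<inter> U) (\<lambda>m. \<psi> m (frame \<phi> j m) i)"
      by (intro B_coord_smooth[OF t(2)] triv_B_section[OF t(1)] triv_B_open[OF t(1)]
          B_frame_mem[OF t(1)]) auto
    then show ?thesis using True by (simp add: g_def[abs_def] Int_commute)
  next
    case False
    then have "g i j = (\<lambda>m. 0)" by (auto simp: g_def)
    then show ?thesis by (simp add: smooth_fun_on_const[OF mfd])
  qed
  moreover have "\<psi> m v i = (\<Sum>j<n. g i j m * \<phi> m v j)"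
    if m: "m \<in> U" "m \<in> V" and v: "v \<in> F m" and i: "i < k" for m v i
  proof -
    have "\<psi> m v i = \<psi> m (\<Sum>j<n. \<phi> m v j \<cdot> frame \<phi> j m) i" using B_expand[OF t(1) m(1) v] by simp
    also have "\<dots> = (\<Sum>j<n. \<phi> m v j * \<psi> m (frame \<phi> j m) i)"
      by (rule B_coord_sum[OF t(2) m(2)]) (simp add: B_frame_mem[OF t(1) m(1)])
    also have "\<dots> = (\<Sum>j<n. g i j m * \<phi> m v j)" using i by (simp add: g_def mult.commute)
    finally show ?thesis .
  qed
  ultimately show "smooth_between M F (\<lambda>m v. v) t t'"
    unfolding t(3,4) smooth_between_def prod.case by blast
qed

end


section \<open>Coordinates on the tangent bundle\<close>

text \<open>The model space need not be of class \<^class>\<open>euclidean_space\<close>, since it may be zero-dimensional;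
so its coordinates come from a basis chosen here.\<close>

lemma linear_coords_exist:
  fixes S :: "'e::real_normed_vector set"
  assumes "finite S" "span S = UNIV"
  obtains n and \<beta> :: "'e \<Rightarrow> nat \<Rightarrow> real" where "linear_coords n \<beta>"
proof -
  obtain B :: "'e set" where B: "B \<subseteq> UNIV" "independent B" "UNIV \<subseteq> span B"
    using basis_exists[of "UNIV :: 'e set"] by metis
  have finB: "finite B" using independent_span_bound[OF assms(1) B(2)] assms(2) by simp
  define n where "n = card B"
  obtain h where h: "bij_betw h {..<n} B"
    using ex_bij_betw_nat_finite[OF finB] by (auto simp: n_def atLeast0LessThan)
  have hB: "h i \<in> B" if "i < n" for i using h that by (auto simp: bij_betw_def)
  have hinj: "h i = h j \<longleftrightarrow> i = j" if "i < n" "j < n" for i j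
    using h that by (auto simp: bij_betw_def inj_on_def)
  define \<beta> where "\<beta> x i = (if i < n then representation B x (h i) else 0)" for x i
  have sp: "x \<in> span B" for x using B(3) by blast
  have rep: "(\<Sum>i<n. \<beta> x i *\<^sub>R h i) = x" for x
  proof -
    have "(\<Sum>i<n. \<beta> x i *\<^sub>R h i) = (\<Sum>i<n. representation B x (h i) *\<^sub>R h i)"
      by (simp add: \<beta>_def)
    also have "\<dots> = (\<Sum>b\<in>B. representation B x b *\<^sub>R b)"
      by (rule sum.reindex_bij_betw[OF h])
    also have "\<dots> = x"
      using real_vector.sum_representation_eq[of B x B] B finB by auto
    finally show ?thesis .
  qed
  have coord: "\<beta> (\<Sum>i<n. y i *\<^sub>R h i) k = y k" if "k < n" for y k
  proof -
    have "representation B (\<Sum>i<n. y i *\<^sub>R h i) (h k) = (\<Sum>i<n. y i * representation B (h i) (h k))"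
      using B by (subst real_vector.representation_sum)
         (auto simp: real_vector.representation_scale sp)
    also have "\<dots> = (\<Sum>i<n. if i = k then y i else 0)"
      using B(2) hB hinj that
      by (intro sum.cong) (auto simp: real_vector.representation_basis)
    finally show ?thesis using that by (simp add: \<beta>_def)
  qed
  have "linear (\<lambda>x. \<beta> x i)" for i
    using B by (cases "i < n")
      (auto simp: \<beta>_def linear_iff real_vector.representation_add real_vector.representation_scale sp)
  moreover have "bij_betw \<beta> UNIV {y. \<forall>i\<ge>n. y i = 0}"
  proof (rule bij_betwI[where g = "\<lambda>y. \<Sum>i<n. y i *\<^sub>R h i"])
    show "\<beta> \<in> UNIV \<rightarrow> {y. \<forall>i\<ge>n. y i = 0}" by (auto simp: \<beta>_def)
    show "\<beta> (\<Sum>i<n. y i *\<^sub>R h i) = y" if "y \<in> {y. \<forall>i\<ge>n. y i = 0}" for y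
    proof
      show "\<beta> (\<Sum>i<n. y i *\<^sub>R h i) k = y k" for k
        using that coord[of k y] by (cases "k < n") (auto simp: \<beta>_def)
    qed
  qed (simp_all add: rep)
  ultimately have "linear_coords n \<beta>" by (simp add: linear_coords_def)
  then show thesis by (rule that)
qed

context
  fixes n and \<beta> :: "'e::real_normed_vector \<Rightarrow> nat \<Rightarrow> real"
  assumes \<beta>: "linear_coords n \<beta>"
begin

lemma coords_linear: "linear (\<lambda>x. \<beta> x i)"
  and coords_bij: "bij_betw \<beta> UNIV {y. \<forall>i\<ge>n. y i = 0}"
  using \<beta> by (auto simp: linear_coords_def)

lemma coords_add: "\<beta> (x + y) i = \<beta> x i + \<beta> y i"
  and coords_scale: "\<beta> (r *\<^sub>R x) i = r * \<beta> x i"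
  and coords_zero: "\<beta> 0 i = 0"
  using coords_linear[of i] linear_0[OF coords_linear[of i]] by (auto simp: linear_iff)

lemma coords_sum: "\<beta> (\<Sum>j\<in>J. f j) i = (\<Sum>j\<in>J. \<beta> (f j) i)"
  by (rule linear_sum[OF coords_linear])

lemma coords_eqI:
  assumes "\<And>i. i < n \<Longrightarrow> \<beta> x i = \<beta> y i"
  shows "x = y"
proof -
  have 0: "\<beta> z i = 0" if "i \<ge> n" for z i using bij_betwE[OF coords_bij] that by blast
  have "\<beta> x = \<beta> y"
  proof
    show "\<beta> x i = \<beta> y i" for i using assms 0 by (cases "i < n") auto
  qed
  then show ?thesis using coords_bij by (auto simp: bij_betw_def dest: injD)
qed

lemma coords_expand: "\<exists>b. \<forall>x. x = (\<Sum>i<n. \<beta> x i *\<^sub>R b i)"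
proof (intro exI allI coords_eqI)
  fix x i assume i: "i < n"
  have b: "\<beta> (inv \<beta> (unit_tuple j)) = unit_tuple j" if "j < n" for j
    using coords_bij that by (intro f_inv_into_f) (auto simp: bij_betw_def)
  have "\<beta> (\<Sum>j<n. \<beta> x j *\<^sub>R inv \<beta> (unit_tuple j)) i = (\<Sum>j<n. \<beta> x j * unit_tuple j i)"
    by (simp add: coords_sum coords_scale b)
  also have "\<dots> = \<beta> x i" using i by (simp add: if_distrib cong: if_cong)
  finally show "\<beta> x i = \<beta> (\<Sum>j<n. \<beta> x j *\<^sub>R inv \<beta> (unit_tuple j)) i" by simp
qed

end

lemma manifold_coords_exist:
  fixes M :: "('m, 'e::real_normed_vector) manifold"
  assumes "smooth_manifold M"
  obtains n and \<beta> :: "'e \<Rightarrow> nat \<Rightarrow> real" where "linear_coords n \<beta>"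
proof -
  obtain S :: "'e set" where "finite S" "span S = UNIV"
    using assms by (auto simp: smooth_manifold_def)
  then show thesis using that by (rule linear_coords_exist)
qed

lemma tangent_bundle_simps [simp]:
  "fibre (tangent_bundle M) = tangent_space M"
  "scl (tangent_bundle M) = (\<lambda>r v c. r *\<^sub>R v c)"
  by (simp_all add: tangent_bundle_def)

lemma tangent_bundle_trivs:
  "(U, n, \<psi>) \<in> trivs (tangent_bundle M) \<longleftrightarrow>
    (\<exists>c \<beta>. c \<in> atlas M \<and> linear_coords n \<beta> \<and> U = fst c \<and> \<psi> = (\<lambda>m v. \<beta> (v c)))"
  by (auto simp: tangent_bundle_def)

lemma complexify_simps [simp]:
  "fibre (complexify E) m = fibre E m \<times> fibre E m"
  "scl (complexify E) z (u, v) =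
    (scl E (Re z) u - scl E (Im z) v, scl E (Re z) v + scl E (Im z) u)"
  by (simp_all add: complexify_def)

lemma complexify_trivs:
  "(U, n, \<psi>) \<in> trivs (complexify E) \<longleftrightarrow>
    (\<exists>\<phi>. (U, n, \<phi>) \<in> trivs E \<and> \<psi> = (\<lambda>m (u, v) i. Complex (\<phi> m u i) (\<phi> m v i)))"
  by (auto simp: complexify_def)

lemma tangent_triv_of_chart:
  "c \<in> atlas M \<Longrightarrow> linear_coords n \<beta> \<Longrightarrow> (fst c, n, \<lambda>m v. \<beta> (v c)) \<in> trivs (tangent_bundle M)"
  unfolding tangent_bundle_trivs by blast

context
  fixes M :: "('m, 'e::real_normed_vector) manifold"
  assumes mfd: "smooth_manifold M"
begin

lemma tangent_trivs_open: "\<forall>t\<in>trivs (tangent_bundle M). openin (mtop M) (fst t)"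
  using open_chart_dom[OF mfd] by (force simp: tangent_bundle_def)

lemma complex_tangent_trivs_open:
  "\<forall>t\<in>trivs (complex_tangent_bundle M). openin (mtop M) (fst t)"
  using tangent_trivs_open by (force simp: complexify_def)

lemma section_parts:
  assumes W: "openin (mtop M) W" and Z: "smooth_section_on M (complex_tangent_bundle M) W Z"
  shows "smooth_section_on M (tangent_bundle M) W (\<lambda>m. fst (Z m))"
    and "smooth_section_on M (tangent_bundle M) W (\<lambda>m. snd (Z m))"
proof -
  have mem: "Z m \<in> tangent_space M m \<times> tangent_space M m" if "m \<in> W" for m
    using smooth_section_mem[OF Z that] by simp
  have "smooth_fun_on M (U \<inter> W) (\<lambda>m. \<psi> m (fst (Z m)) i) \<and>
      smooth_fun_on M (U \<inter> W) (\<lambda>m. \<psi> m (snd (Z m)) i)"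
    if t: "(U, n, \<psi>) \<in> trivs (tangent_bundle M)" and i: "i < n" for U n \<psi> i
  proof -
    have o: "openin (mtop M) (U \<inter> W)" using bspec[OF tangent_trivs_open t] W by auto
    have "(U, n, \<lambda>m (u, v) i. Complex (\<psi> m u i) (\<psi> m v i)) \<in> trivs (complex_tangent_bundle M)"
      using t by (auto simp: complexify_trivs)
    from smooth_section_coord[OF Z this i]
    have "smooth_fun_on M (U \<inter> W) (\<lambda>m. Complex (\<psi> m (fst (Z m)) i) (\<psi> m (snd (Z m)) i))"
      by (simp add: case_prod_beta)
    from smooth_fun_on_bounded_linear[OF mfd bounded_linear_Re o this]
      smooth_fun_on_bounded_linear[OF mfd bounded_linear_Im o this]
    show ?thesis by simp
  qed
  then show "smooth_section_on M (tangent_bundle M) W (\<lambda>m. fst (Z m))"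
    "smooth_section_on M (tangent_bundle M) W (\<lambda>m. snd (Z m))"
    using mem by (auto intro!: smooth_section_onI simp: mem_Times_iff)
qed

text \<open>The other coordinate representations arise from the one in \<open>c\<close> by linear maps. Hence the imaginary
part of the anchor vanishes as soon as finitely many real functionals do, namely its coordinates in
one chart.\<close>

lemma tangent_vector_eq_0:
  assumes v: "v \<in> tangent_space M m" and c: "c \<in> atlas M" "m \<in> fst c" "v c = 0"
  shows "v = 0"
proof
  fix d
  show "v d = 0 d"
  proof (cases "d \<in> atlas M \<and> m \<in> fst d")
    case True
    have "smooth_on (snd c ` (fst c \<inter> fst d)) (snd d \<circ> chart_inv c)"
      using mfd c True by (auto simp: smooth_manifold_def)
    then have "diff_times_on (Suc 0) (snd c ` (fst c \<inter> fst d)) (snd d \<circ> chart_inv c)"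
      unfolding smooth_on_def by blast
    then have "(snd d \<circ> chart_inv c) differentiable (at (snd c m))" using c True by simp
    from linear_0[OF linear_frechet_derivative[OF this]]
    moreover have "v d = frechet_derivative (snd d \<circ> chart_inv c) (at (snd c m)) (v c)"
      using v c(1,2) True unfolding tangent_space_def by blast
    ultimately show ?thesis using c(3) by simp
  next
    case False
    then have "v d = 0" using v unfolding tangent_space_def by blast
    then show ?thesis by simp
  qed
qed

text \<open>Smoothness of a vector field is given for the components in linear coordinates, from which the
field with values in the model space is put together.\<close>

lemma tangent_section_differentiable:
  assumes X: "smooth_section_on M (tangent_bundle M) (points M) X"
    and c: "c \<in> atlas M" "m \<in> fst c"
  shows "(\<lambda>x. X (chart_inv c x) c) differentiable (at (snd c m))"
proof -
  obtain n and \<beta> :: "'e \<Rightarrow> nat \<Rightarrow> real" where \<beta>: "linear_coords n \<beta>"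
    by (rule manifold_coords_exist[OF mfd])
  obtain b where b: "\<And>x. x = (\<Sum>i<n. \<beta> x i *\<^sub>R b i)" using coords_expand[OF \<beta>] by blast
  have "(\<lambda>x. \<beta> (X (chart_inv c x) c) i) differentiable (at (snd c m))" if i: "i < n" for i
  proof -
    have "(fst c, n, \<lambda>m v. \<beta> (v c)) \<in> trivs (tangent_bundle M)"
      by (rule tangent_triv_of_chart[OF c(1) \<beta>])
    from smooth_section_coord[OF X this i]
    have "smooth_fun_on M (fst c \<inter> points M) (\<lambda>m. \<beta> (X m c) i)" .
    then have "diff_times_on (Suc 0) (snd c ` (fst c \<inter> (fst c \<inter> points M)))
        (\<lambda>x. \<beta> (X (chart_inv c x) c) i)"
      unfolding smooth_fun_on_iff[OF mfd] using c(1) by blast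
    moreover have "m \<in> points M" using openin_points[OF open_chart_dom[OF mfd c(1)] c(2)] .
    ultimately show ?thesis using c by simp
  qed
  then have "(\<lambda>x. \<Sum>i<n. \<beta> (X (chart_inv c x) c) i *\<^sub>R b i) differentiable (at (snd c m))"
    by (intro differentiable_sum differentiable_scaleR) auto
  then show ?thesis by (simp add: b[symmetric])
qed

text \<open>Differentiability of the field is essential: the \<^const>\<open>frechet_derivative\<close> of a function that is
not differentiable need not send \<open>0\<close> to \<open>0\<close>.\<close>

lemma lie_bracket_zero_left:
  assumes "smooth_section_on M (tangent_bundle M) (points M) X"
  shows "lie_bracket M (\<lambda>m. 0) X m = 0"
proof
  fix c
  show "lie_bracket M (\<lambda>m. 0) X m c = 0 c"
    using linear_0[OF linear_frechet_derivative[OF tangent_section_differentiable[OF assms]]]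
    by (simp add: lie_bracket_def)
qed

lemma lie_bracket_zero_right:
  assumes "smooth_section_on M (tangent_bundle M) (points M) X"
  shows "lie_bracket M X (\<lambda>m. 0) m = 0"
proof
  fix c
  show "lie_bracket M X (\<lambda>m. 0) m c = 0 c"
    using linear_0[OF linear_frechet_derivative[OF tangent_section_differentiable[OF assms]]]
    by (simp add: lie_bracket_def)
qed

lemma complex_lie_bracket_of_real:
  assumes "smooth_section_on M (tangent_bundle M) (points M) X"
    and "smooth_section_on M (tangent_bundle M) (points M) Y"
  shows "complex_lie_bracket M (\<lambda>m. (X m, 0)) (\<lambda>m. (Y m, 0)) = (\<lambda>m. (lie_bracket M X Y m, 0))"
proof -
  have "lie_bracket M (\<lambda>m. 0) (\<lambda>m. 0) = (\<lambda>m. 0)"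
    by (simp add: lie_bracket_def fun_eq_iff)
  then show ?thesis
    unfolding complex_lie_bracket_def
    by (simp add: comp_def lie_bracket_zero_left[OF assms(2)] lie_bracket_zero_right[OF assms(1)])
qed

end


section \<open>The real part of an involutive complex anchored bundle\<close>

context smooth_bundle
begin

lemma bundle_map_zero: "bundle_map M E E' h \<Longrightarrow> m \<in> points M \<Longrightarrow> h m 0 = 0"
  using subspace_0[OF fibre_subspace[of m]] unfolding bundle_map_def
  by (metis add.right_neutral add_left_cancel)

lemma sections_zero: "(\<lambda>m. 0) \<in> sections M E"
  using section_zero[of "points M"] by (simp add: sections_def)

lemma sections_add: "s \<in> sections M E \<Longrightarrow> s' \<in> sections M E \<Longrightarrow> (\<lambda>m. s m + s' m) \<in> sections M E"
  using section_add[of "points M" s s'] by (simp add: sections_def)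

lemma sections_scale: "s \<in> sections M E \<Longrightarrow> (\<lambda>m. scl E a (s m)) \<in> sections M E"
  using section_scale[OF _ smooth_fun_on_const[OF mfd], of "points M" s a] by (simp add: sections_def)

lemma sections_mem: "s \<in> sections M E \<Longrightarrow> m \<in> points M \<Longrightarrow> s m \<in> fibre E m"
  by (auto simp: sections_def dest: smooth_section_mem)

end

lemma tangent_fields_module:
  "module (\<lambda>a X m. scl (tangent_bundle M) a (X m))"
  by unfold_locales (auto simp: fun_eq_iff scaleR_add_right scaleR_add_left)

text \<open>This holds for every real anchored bundle; closure under the bracket is the only part of being a
Lie subalgebra that depends on involutivity.\<close>

lemma anchor_image_subspace:
  assumes "smooth_bundle M E" and h: "bundle_map M E (tangent_bundle M) h"
  shows "anchor_image M E h \<subseteq> sections M (tangent_bundle M)"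
    and "module.subspace (\<lambda>a X m. scl (tangent_bundle M) a (X m)) (anchor_image M E h)"
proof -
  interpret smooth_bundle M E by fact
  show "anchor_image M E h \<subseteq> sections M (tangent_bundle M)"
  proof
    fix X assume "X \<in> anchor_image M E h"
    then obtain s where s: "s \<in> sections M E" and X: "X = (\<lambda>m. if m \<in> points M then h m (s m) else 0)"
      by (auto simp: anchor_image_def)
    have "smooth_section_on M (tangent_bundle M) (points M) (\<lambda>m. h m (s m))"
      using s by (intro bundle_map_section[OF h] tangent_trivs_open[OF mfd]) (auto simp: sections_def)
    then have "smooth_section_on M (tangent_bundle M) (points M) X"
      by (rule smooth_section_on_cong[OF mfd tangent_trivs_open[OF mfd]]) (auto simp: X)
    then show "X \<in> sections M (tangent_bundle M)" by (simp add: sections_def X)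
  qed
  have ha: "h m (v + w) = h m v + h m w" if "m \<in> points M" "v \<in> fibre E m" "w \<in> fibre E m" for m v w
    using h that unfolding bundle_map_def by blast
  have hs: "h m (scl E a v) = scl (tangent_bundle M) a (h m v)"
    if "m \<in> points M" "v \<in> fibre E m" for m a v
    using h that unfolding bundle_map_def by blast
  let ?im = "\<lambda>s m. if m \<in> points M then h m (s m) else 0"
  show "module.subspace (\<lambda>a X m. scl (tangent_bundle M) a (X m)) (anchor_image M E h)"
    unfolding module.subspace_def[OF tangent_fields_module] anchor_image_def
  proof (intro conjI ballI allI)
    have "0 = ?im (\<lambda>m. 0)" using bundle_map_zero[OF h] by (auto simp: fun_eq_iff)
    then show "0 \<in> ?im ` sections M E" using sections_zero by (rule image_eqI)
  next
    fix X Y assume "X \<in> ?im ` sections M E" "Y \<in> ?im ` sections M E"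
    then obtain s s' where s: "s \<in> sections M E" "s' \<in> sections M E" "X = ?im s" "Y = ?im s'" by blast
    then have "X + Y = ?im (\<lambda>m. s m + s' m)" by (auto simp: fun_eq_iff ha sections_mem)
    then show "X + Y \<in> ?im ` sections M E" using sections_add[OF s(1,2)] by (rule image_eqI)
  next
    fix a X assume "X \<in> ?im ` sections M E"
    then obtain s where s: "s \<in> sections M E" "X = ?im s" by blast
    then have "(\<lambda>m. scl (tangent_bundle M) a (X m)) = ?im (\<lambda>m. scl E a (s m))"
      by (auto simp: fun_eq_iff hs sections_mem)
    then show "(\<lambda>m. scl (tangent_bundle M) a (X m)) \<in> ?im ` sections M E"
      using sections_scale[OF s(1)] by (rule image_eqI)
  qed
qed

locale complex_anchor = complex_bundle M A
  for M :: "('m, 'e::real_normed_vector) manifold"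
    and A :: "(complex, 'm, 'v::ab_group_add) vbundle" +
  fixes \<rho> :: "'m \<Rightarrow> 'v \<Rightarrow> ('m, 'e) tangent \<times> ('m, 'e) tangent"
  assumes anchor: "bundle_map M A (complex_tangent_bundle M) \<rho>"
begin

lemma anchor_add:
    "m \<in> points M \<Longrightarrow> v \<in> fibre A m \<Longrightarrow> w \<in> fibre A m \<Longrightarrow> \<rho> m (v + w) = \<rho> m v + \<rho> m w"
  and anchor_scale:
    "m \<in> points M \<Longrightarrow> v \<in> fibre A m \<Longrightarrow> \<rho> m (scl A z v) = scl (complex_tangent_bundle M) z (\<rho> m v)"
  and anchor_mem:
    "m \<in> points M \<Longrightarrow> v \<in> fibre A m \<Longrightarrow> \<rho> m v \<in> tangent_space M m \<times> tangent_space M m"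
  using anchor unfolding bundle_map_def by auto

lemma anchor_real_scale:
  assumes "m \<in> points M" "v \<in> fibre A m"
  shows "fst (\<rho> m (r \<cdot> v)) = (\<lambda>c. r *\<^sub>R fst (\<rho> m v) c)"
    and "snd (\<rho> m (r \<cdot> v)) = (\<lambda>c. r *\<^sub>R snd (\<rho> m v) c)"
  by (cases "\<rho> m v"; simp add: anchor_scale[OF assms] fun_eq_iff)+

lemma re_fibre_iff: "v \<in> re_fibre A \<rho> m \<longleftrightarrow> v \<in> fibre A m \<and> snd (\<rho> m v) = 0"
  by (simp add: re_fibre_def anchor2_def)

sublocale re: real_subspace_family M A "re_fibre A \<rho>"
proof
  fix m assume m: "m \<in> points M"
  show "re_fibre A \<rho> m \<subseteq> fibre A m" by (auto simp: re_fibre_iff)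
  note sub = fibre_R_subspace[OF m]
  show "R.subspace (re_fibre A \<rho> m)"
    using R.subspace_0[OF sub] R.subspace_add[OF sub] R.subspace_scale[OF sub]
    by (intro R.subspaceI)
       (auto simp: re_fibre_iff anchor_add[OF m] anchor_real_scale[OF m] bundle_map_zero[OF anchor m]
         fun_eq_iff)
qed

lemma anchor_section:
  assumes "openin (mtop M) W" "smooth_section_on M A W s"
  shows "smooth_section_on M (tangent_bundle M) W (\<lambda>m. fst (\<rho> m (s m)))"
    and "smooth_section_on M (tangent_bundle M) W (\<lambda>m. snd (\<rho> m (s m)))"
  using section_parts[OF mfd assms(1) bundle_map_section[OF anchor assms(1)
        complex_tangent_trivs_open[OF mfd] assms(2)]] by blast+

lemma imaginary_anchor_functional:
  assumes c: "c \<in> atlas M" and \<beta>: "linear_coords n \<beta>" and i: "i < n"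
  shows "smooth_functional (fst c) (\<lambda>m v. \<beta> (snd (\<rho> m v) c) i)"
  unfolding smooth_functional_def
proof (intro conjI ballI allI impI)
  fix m v assume m: "m \<in> fst c" and v: "v \<in> fibre A m"
  have mp: "m \<in> points M" using openin_points[OF open_chart_dom[OF mfd c] m] .
  show "\<beta> (snd (\<rho> m (v + w)) c) i = \<beta> (snd (\<rho> m v) c) i + \<beta> (snd (\<rho> m w) c) i"
    if "w \<in> fibre A m" for w
    by (simp add: anchor_add[OF mp v that] coords_add[OF \<beta>])
  show "\<beta> (snd (\<rho> m (r \<cdot> v)) c) i = r * \<beta> (snd (\<rho> m v) c) i" for r
    by (simp add: anchor_real_scale[OF mp v] coords_scale[OF \<beta>])
next
  fix W s assume W: "openin (mtop M) W" "W \<subseteq> fst c" and s: "smooth_section_on M A W s"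
  have "(fst c, n, \<lambda>m v. \<beta> (v c)) \<in> trivs (tangent_bundle M)"
    by (rule tangent_triv_of_chart[OF c \<beta>])
  from smooth_section_coord[OF anchor_section(2)[OF W(1) s] this i]
  show "smooth_fun_on M W (\<lambda>m. \<beta> (snd (\<rho> m (s m)) c) i)" using W(2) by (simp add: Int_absorb1)
qed

lemma re_fibre_kernel:
  assumes c: "c \<in> atlas M" "m \<in> fst c" and \<beta>: "linear_coords n \<beta>"
  shows "re_fibre A \<rho> m = {v \<in> fibre A m. \<forall>i<n. \<beta> (snd (\<rho> m v) c) i = 0}"
proof -
  have mp: "m \<in> points M" using openin_points[OF open_chart_dom[OF mfd c(1)] c(2)] .
  have "snd (\<rho> m v) = 0" if "v \<in> fibre A m" "\<forall>i<n. \<beta> (snd (\<rho> m v) c) i = 0" for v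
  proof (rule tangent_vector_eq_0[OF mfd _ c])
    show "snd (\<rho> m v) \<in> tangent_space M m" using anchor_mem[OF mp that(1)] by (simp add: mem_Times_iff)
    show "snd (\<rho> m v) c = 0" by (rule coords_eqI[OF \<beta>]) (simp add: that(2) coords_zero[OF \<beta>])
  qed
  then show ?thesis by (auto simp: re_fibre_iff coords_zero[OF \<beta>])
qed

text \<open>Near a point, a chart turns the condition that the imaginary part of the anchor vanishes into the
vanishing of finitely many smooth functionals, and the constancy of the real rank provides a frame of their
kernel.\<close>

lemma re_bundle_cover:
  assumes rank: "\<And>m. m \<in> points M \<Longrightarrow> real_rank A \<rho> m = k" and m: "m \<in> points M"
  shows "\<exists>t\<in>trivs re.B. m \<in> fst t"
proof -
  obtain n and \<beta> :: "'e \<Rightarrow> nat \<Rightarrow> real" where \<beta>: "linear_coords n \<beta>"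
    by (rule manifold_coords_exist[OF mfd])
  obtain c where c: "c \<in> atlas M" "m \<in> fst c" using chart_exists[OF mfd m] .
  note o = open_chart_dom[OF mfd c(1)]
  obtain W e where W: "openin (mtop M) W" "m \<in> W" "W \<subseteq> fst c"
    and e: "\<And>j. j < k \<Longrightarrow> smooth_section_on M A W (e j)"
      "\<And>m. m \<in> W \<Longrightarrow> independent_family {..<k} (\<lambda>j. e j m)"
      "\<And>m. m \<in> W \<Longrightarrow> re_fibre A \<rho> m = range (\<lambda>x. \<Sum>j<k. x j \<cdot> e j m)"
  proof (rule constant_rank_kernel_frame[OF o c(2), of n "\<lambda>i m v. \<beta> (snd (\<rho> m v) c) i" "re_fibre A \<rho>" k])
    show "R.dim (re_fibre A \<rho> m') = k" if "m' \<in> fst c" for m'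
      using rank[OF openin_points[OF o that]] by (simp add: real_rank_def)
  qed (use imaginary_anchor_functional[OF c(1) \<beta>] re_fibre_kernel[OF c(1) _ \<beta>] in auto)
  obtain \<phi> where "(W, k, \<phi>) \<in> trivs re.B" using re.triv_B_of_frame[OF W(1) e] by blast
  then show ?thesis using W(2) by force
qed

text \<open>The matrix of the real anchor has the components of the vector fields \<open>\<rho>\<^sub>1 (frame j)\<close> as its
columns. They are smooth because the frame consists of smooth sections of \<open>A\<close>.\<close>

lemma re_anchor_bundle_map: "bundle_map M re.B (tangent_bundle M) (re_anchor \<rho>)"
  unfolding bundle_map_def re.B_simps tangent_bundle_simps
proof (intro conjI ballI allI)
  fix m v assume m: "m \<in> points M" and v: "v \<in> re_fibre A \<rho> m"
  then have vA: "v \<in> fibre A m" by (simp add: re_fibre_iff)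
  show "re_anchor \<rho> m v \<in> tangent_space M m"
    using anchor_mem[OF m vA] by (simp add: anchor1_def mem_Times_iff)
  show "re_anchor \<rho> m (v + w) = re_anchor \<rho> m v + re_anchor \<rho> m w" if "w \<in> re_fibre A \<rho> m" for w
    using that anchor_add[OF m vA] by (simp add: anchor1_def re_fibre_iff)
  show "re_anchor \<rho> m (r \<cdot> v) = (\<lambda>c. r *\<^sub>R re_anchor \<rho> m v c)" for r
    using anchor_real_scale[OF m vA] by (simp add: anchor1_def)
next
  fix t t' assume t0: "t \<in> trivs re.B" and t'0: "t' \<in> trivs (tangent_bundle M)"
  obtain U n \<phi> V k \<psi> where eq: "t = (U, n, \<phi>)" "t' = (V, k, \<psi>)" by (cases t; cases t')
  note t = t0[unfolded eq] and t' = t'0[unfolded eq]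
  obtain c \<beta> where c: "c \<in> atlas M" "V = fst c" and \<beta>: "linear_coords k \<beta>"
    and \<psi>: "\<psi> = (\<lambda>m v. \<beta> (v c))" using t' by (auto simp: tangent_bundle_trivs)
  define g where "g i j m = (if i < k \<and> j < n then \<beta> (fst (\<rho> m (re.frame \<phi> j m)) c) i else 0)" for i j m
  have "smooth_fun_on M (U \<inter> V) (g i j)" for i j
  proof (cases "i < k \<and> j < n")
    case True
    have "smooth_section_on M (tangent_bundle M) U (\<lambda>m. fst (\<rho> m (re.frame \<phi> j m)))"
      using True by (intro anchor_section re.triv_B_open[OF t] re.triv_B_section[OF t]) auto
    from smooth_section_coord[OF this t'] True show ?thesis
      by (simp add: g_def[abs_def] \<psi> Int_commute)
  next
    case False
    then have "g i j = (\<lambda>m. 0)" by (auto simp: g_def)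
    then show ?thesis by (simp add: smooth_fun_on_const[OF mfd])
  qed
  moreover have "\<psi> m (re_anchor \<rho> m v) i = (\<Sum>j<n. g i j m * \<phi> m v j)"
    if m: "m \<in> U" "m \<in> V" and v: "v \<in> re_fibre A \<rho> m" and i: "i < k" for m v i
  proof -
    have mp: "m \<in> points M" using openin_points[OF re.triv_B_open[OF t] m(1)] .
    have mem: "re.frame \<phi> j m \<in> fibre A m" if "j < n" for j
      using re.B_frame_mem[OF t m(1) that] by (simp add: re_fibre_iff)
    have "fst (\<rho> m (\<Sum>j\<in>J. x j \<cdot> re.frame \<phi> j m)) c = (\<Sum>j\<in>J. x j *\<^sub>R fst (\<rho> m (re.frame \<phi> j m)) c)"
      if "J \<subseteq> {..<n}" "finite J" for x J
      using that(2,1)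
    proof (induction J rule: finite_induct)
      case empty
      then show ?case by (simp add: bundle_map_zero[OF anchor mp])
    next
      case (insert j J)
      have "(\<Sum>j\<in>J. x j \<cdot> re.frame \<phi> j m) \<in> fibre A m"
        using insert.prems mem
        by (intro R.subspace_sum R.subspace_scale fibre_R_subspace mp) auto
      moreover have "re.frame \<phi> j m \<in> fibre A m" using insert.prems mem by auto
      ultimately show ?case
        using insert R.subspace_scale[OF fibre_R_subspace[OF mp]]
        by (simp add: anchor_add[OF mp] anchor_real_scale[OF mp])
    qed
    from this[of "{..<n}" "\<phi> m v"]
    have "fst (\<rho> m v) c = (\<Sum>j<n. \<phi> m v j *\<^sub>R fst (\<rho> m (re.frame \<phi> j m)) c)"
      by (simp add: re.B_expand[OF t m(1) v])
    then have "\<beta> (fst (\<rho> m v) c) i = (\<Sum>j<n. \<phi> m v j * \<beta> (fst (\<rho> m (re.frame \<phi> j m)) c) i)"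
      by (simp add: coords_sum[OF \<beta>] coords_scale[OF \<beta>])
    then show ?thesis using i by (simp add: \<psi> anchor1_def g_def mult.commute)
  qed
  ultimately show "smooth_between M (re_fibre A \<rho>) (re_anchor \<rho>) t t'"
    unfolding eq smooth_between_def prod.case by blast
qed

end

theorem lemma2p9:
  fixes M :: "('m, 'e::real_normed_vector) manifold"
    and A :: "(complex, 'm, 'v::ab_group_add) vbundle"
    and \<rho> :: "'m \<Rightarrow> 'v \<Rightarrow> ('m, 'e) tangent \<times> ('m, 'e) tangent"
  assumes "smooth_manifold M"
    and "complex_anchored_bundle M A \<rho>"
    and "complex_involutive M A \<rho>"
    and "\<exists>k. \<forall>m\<in>points M. real_rank A \<rho> m = k"
  shows "real_anchored_bundle M (re_bundle M A \<rho>) (re_anchor \<rho>) \<and>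
         real_involutive M (re_bundle M A \<rho>) (re_anchor \<rho>)"
proof -
  interpret complex_anchor M A \<rho>
    using assms(1,2) by unfold_locales (simp_all add: complex_anchored_bundle_def)
  have B: "re_bundle M A \<rho> = re.B" by (simp add: re_bundle_def)
  obtain k where "\<And>m. m \<in> points M \<Longrightarrow> real_rank A \<rho> m = k" using assms(4) by blast
  note cover = re_bundle_cover[OF this]
  have vb: "vector_bundle M re.B" by (rule re.vector_bundle_B[OF cover])
  then interpret B: smooth_bundle M re.B using mfd by unfold_locales
  have br: "lie_bracket M X Y \<in> anchor_image M re.B (re_anchor \<rho>)"
    if XY: "X \<in> anchor_image M re.B (re_anchor \<rho>)" "Y \<in> anchor_image M re.B (re_anchor \<rho>)" for X Y
  proof -
    \<comment> \<open>real fields in the image are also in the image of the complex anchor, with imaginary part zero\<close>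
    have complex: "(\<lambda>m. (X m, 0)) \<in> anchor_image M A \<rho>"
      and smooth: "smooth_section_on M (tangent_bundle M) (points M) X"
      if X: "X \<in> anchor_image M re.B (re_anchor \<rho>)" for X
    proof -
      obtain s where s: "s \<in> sections M re.B"
        and Xs: "X = (\<lambda>m. if m \<in> points M then re_anchor \<rho> m (s m) else 0)"
        using X unfolding anchor_image_def by blast
      have "s m \<in> re_fibre A \<rho> m" if "m \<in> points M" for m using B.sections_mem[OF s that] by simp
      then have "(\<lambda>m. (X m, 0)) = (\<lambda>m. if m \<in> points M then \<rho> m (s m) else 0)"
        by (auto simp: fun_eq_iff Xs re_fibre_iff anchor1_def prod_eq_iff)
      moreover have "s \<in> sections M A"
        using s re.section_A_if_section_B[OF cover, of "points M" s] by (simp add: sections_def)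
      ultimately show "(\<lambda>m. (X m, 0)) \<in> anchor_image M A \<rho>" unfolding anchor_image_def by (rule image_eqI)
      show "smooth_section_on M (tangent_bundle M) (points M) X"
        using anchor_image_subspace(1)[OF B.smooth_bundle_axioms re_anchor_bundle_map] X
        by (auto simp: sections_def)
    qed
    have "complex_lie_bracket M (\<lambda>m. (X m, 0)) (\<lambda>m. (Y m, 0)) \<in> anchor_image M A \<rho>"
      using assms(3) complex[OF XY(1)] complex[OF XY(2)]
      unfolding complex_involutive_def lie_subalgebra_def by blast
    then have "(\<lambda>m. (lie_bracket M X Y m, 0)) \<in> anchor_image M A \<rho>"
      by (simp add: complex_lie_bracket_of_real[OF mfd smooth[OF XY(1)] smooth[OF XY(2)]])
    then obtain u where u: "u \<in> sections M A"
      and eq: "(\<lambda>m. (lie_bracket M X Y m, 0)) = (\<lambda>m. if m \<in> points M then \<rho> m (u m) else 0)"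
      unfolding anchor_image_def by blast
    have on: "\<rho> m (u m) = (lie_bracket M X Y m, 0)" if "m \<in> points M" for m
      using fun_cong[OF eq, of m] that by simp
    have off: "lie_bracket M X Y m = 0" if "m \<notin> points M" for m
      using fun_cong[OF eq, of m] that by (simp add: zero_prod_def)
    \<comment> \<open>the bracket is real, so the complex section that realizes it lies in the kernel of \<open>\<rho>\<^sub>2\<close>\<close>
    have "u m \<in> re_fibre A \<rho> m" if "m \<in> points M" for m
      using sections_mem[OF u that] on[OF that] by (simp add: re_fibre_iff)
    then have "u \<in> sections M re.B"
      using u re.section_B_if_section_A[of "points M" u] by (simp add: sections_def)
    moreover have "lie_bracket M X Y = (\<lambda>m. if m \<in> points M then re_anchor \<rho> m (u m) else 0)"
      using on off by (auto simp: fun_eq_iff anchor1_def)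
    ultimately show ?thesis unfolding anchor_image_def by blast
  qed
  have "lie_subalgebra M (tangent_bundle M) (lie_bracket M) (anchor_image M re.B (re_anchor \<rho>))"
    unfolding lie_subalgebra_def
    using anchor_image_subspace[OF B.smooth_bundle_axioms re_anchor_bundle_map] br by blast
  then show ?thesis
    unfolding B real_anchored_bundle_def real_involutive_def using vb re_anchor_bundle_map by blast
qed

end
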